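(* Let $Q=[0,1]^3$. For a finite set $Y=\{y_1,\dots,y_n\}\subseteq Q$ define the energy \[E(Y)=\int_Q \operatorname{dist}^2(x,Y)\,dx=\sum_{k=1}^n\int_{V_k}|x-y_k|^2\,dx,\] where $V_k=\{x\in Q: |x-y_k|\le |x-y_i|\ \forall i\neq k\}$ is the Voronoi cell of $y_k$. Let $\omega_3:=4\pi/3$ and define the constants \[\Gamma_1:=\frac{(2/5)^{2/3}}{40},\qquad \Gamma_3:=\omega_3^{-1/5}\Gamma_1^{1/5},\qquad \Gamma_5:=\frac14\Big(\sqrt{1+\tfrac{2^4\cdot 3^3}{5^2\cdot 10^3}}-1\Big)\Gamma_3,\] \[\Gamma_4:=\frac{2\cdot 12^{1/4}\,16^{1/3}}{\pi^{1/4}\omega_3^{1/12}}\Big(\sqrt{1+\tfrac{2^4\cdot 3^3}{5^2\cdot 10^3}}-1\Big)^{-1/2}\Big(\frac{5^2\cdot 10^3}{2^2\cdot 3^3}\Big)^{1/4},\qquad N_\ast:=2(3\Gamma_4/\Gamma_5)^3 .\] (Numerically $\Gamma_1\approx 0.013572$, $\Gamma_3\approx0.317769$, $\Gamma_5\approx 0.000451$, $\Gamma_4\approx 333.18$, $N_\ast\approx 2.94\times 10^{20}$.) (i) Let $n\in\mathbb{N}$ and let $Y_n$ be a minimizer of $E$ among all sets of $n$ points in $Q$. Then for every $y\in Y_n$, with $V$ its Voronoi cell, \[\operatorname{diam}(V)\ge \Gamma_3 n^{-1/3},\qquad |V|\ge \omega_3\Gamma_5^3 n^{-1},\qquad \operatorname{diam}(V)\le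 \Gamma_4 (n-2)^{-1/3},\] and $V$ has at most $N_\ast$ faces. (ii) Let $(Y_n)_n$ be a sequence of minimizers, $Y_n\in\operatorname{argmin}_{\sharp Y=n}E(Y)$, and let $\tau>0$ be the constant such that $n^{2/3}E(Y_n)\to\tau$ for every such sequence of minimizers. Then \[n^{2/3}E(Y_n)\ge \tau\quad\text{for all } n\gg 1,\qquad\text{and}\qquad \tau\ge \frac{2\pi}{5}\,\omega_3^{-5/3}\approx 0.11545 .\]
   Context: Minimizers are taken over all sets $Y\subseteq Q$ with exactly $n$ points ($\sharp Y=n$). Voronoi cells are taken inside $Q$ and are convex polytopes. The existence of the constant $\tau$ in (ii) (the limit $n^{2/3}E(Y_n)\to\tau$ for any sequence of minimizers) is a known result (Zador's formula) taken as given. *)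

theory Defs
  imports "HOL-Analysis.Analysis"
begin

definition cubeQ :: "(real^3) set" where
  "cubeQ = cbox 0 1"

definition energy :: "(real^3) set \<Rightarrow> real" where
  "energy Y = integral cubeQ (\<lambda>x. (infdist x Y)\<^sup>2)"

definition voronoi_cell :: "(real^3) set \<Rightarrow> real^3 \<Rightarrow> (real^3) set" where
  "voronoi_cell Y y = {x \<in> cubeQ. \<forall>z\<in>Y. dist x y \<le> dist x z}"

definition minimizer :: "nat \<Rightarrow> (real^3) set \<Rightarrow> bool" where
  "minimizer n Y \<longleftrightarrow> Y \<subseteq> cubeQ \<and> finite Y \<and> card Y = n \<and>
     (\<forall>Z. Z \<subseteq> cubeQ \<and> finite Z \<and> card Z = n \<longrightarrow> energy Y \<le> energy Z)"

definition omega3 :: real where "omega3 = 4 * pi / 3"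

definition Gamma1 :: real where "Gamma1 = (2/5) powr (2/3) / 40"

definition Gamma3 :: real where "Gamma3 = omega3 powr (-1/5) * Gamma1 powr (1/5)"

definition sqrtterm :: real where
  "sqrtterm = sqrt (1 + (2^4 * 3^3) / (5^2 * 10^3)) - 1"

definition Gamma5 :: real where "Gamma5 = (1/4) * sqrtterm * Gamma3"

definition Gamma4 :: real where
  "Gamma4 = (2 * 12 powr (1/4) * 16 powr (1/3)) / (pi powr (1/4) * omega3 powr (1/12))
            * sqrtterm powr (-1/2) * ((5^2 * 10^3) / (2^2 * 3^3)) powr (1/4)"

definition Nstar :: real where "Nstar = 2 * (3 * Gamma4 / Gamma5)^3"

end

theory Submission
  imports Defs
begin

text \<open>
  Compare a minimizer \<open>Y\<close> of \<open>n\<close> points with configurations obtained by removing and adding a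
  point. Since \<open>Y\<close> is centroidal, removing \<open>y\<close> and giving its cell \<open>V\<close> to another point \<open>y'\<close>
  costs at most \<open>|V| |y - y'|\<^sup>2\<close>. Adding a point to any \<open>n\<close> points gains at least a constant
  times \<open>n\<^sup>-\<^sup>5\<^sup>/\<^sup>3\<close> (split a cell of volume at least \<open>1/n\<close> along one of six directions), and
  adding a point at distance \<open>R\<close> from \<open>Y\<close> gains at least \<open>R\<^sup>5 / 1024\<close>. By minimality the gain
  never exceeds the cost. Removing a point with a cell of volume at most \<open>1/n\<close> bounds the covering
  radius, hence all diameters, from above; removing an arbitrary \<open>y\<close> whose nearest neighbour is
  \<open>y'\<close> bounds \<open>|V|\<close> and \<open>diam V\<close> from below. Neighbouring cells lie in a ball of radius
  comparable to \<open>n\<^sup>-\<^sup>1\<^sup>/\<^sup>3\<close> and have volume at least comparable to \<open>1/n\<close>, so there are boundedly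
  many.

  For the second part, eight half-size copies of a minimizer show that \<open>n\<^sup>2\<^sup>/\<^sup>3 E(Y\<^sub>n)\<close> does not
  increase along \<open>n, 8n, 64n, \<dots>\<close>, so its limit is a lower bound; and the points within
  distance \<open>s\<close> of \<open>Y\<close> have measure at most \<open>n omega3 s\<^sup>3\<close>, which bounds the energy from below.
\<close>

section \<open>The unit cube and bodies that fit into it\<close>

lemma mem_cubeQ: "x \<in> cubeQ \<longleftrightarrow> (\<forall>i. 0 \<le> x$i \<and> x$i \<le> 1)"
  by (auto simp: cubeQ_def mem_box_cart)

lemma compact_cubeQ: "compact cubeQ" and convex_cubeQ: "convex cubeQ" and closed_cubeQ: "closed cubeQ"
  by (auto simp: cubeQ_def)

lemma measure_cubeQ: "measure lebesgue cubeQ = 1"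
proof -
  have "(0::real^3) \<in> cubeQ" by (simp add: mem_cubeQ)
  then show ?thesis by (auto simp: cubeQ_def content_cbox_if_cart)
qed

lemma infinite_cubeQ: "infinite cubeQ"
proof
  assume "finite cubeQ"
  then have "measure lebesgue cubeQ = 0"
    using negligible_finite negligible_imp_measure0 by blast
  then show False by (simp add: measure_cubeQ)
qed

lemma omega3_bounds: "4 < omega3" "omega3 < 5"
  using pi_gt3 pi_less_4 by (auto simp: omega3_def) (use pi_approx in simp)

lemma measure_ball_3:
  fixes c :: "real^3"
  assumes "0 \<le> r"
  shows "measure lebesgue (ball c r) = omega3 * r^3" "measure lebesgue (cball c r) = omega3 * r^3"
  using content_ball[OF assms, of c] content_cball[OF assms, of c]
  by (simp_all add: omega3_def eval_unit_ball_vol)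

lemma norm_sq_3: "(norm (x::real^3))\<^sup>2 = (x$1)\<^sup>2 + (x$2)\<^sup>2 + (x$3)\<^sup>2"
  unfolding power2_norm_eq_inner inner_vec_def sum_3 by (simp add: power2_eq_square)

lemma dist_cubeQ_le_2:
  assumes "x \<in> cubeQ" "y \<in> cubeQ"
  shows "dist x y \<le> 2"
proof -
  have *: "\<bar>(x - y)$i\<bar> \<le> 1" for i
    using assms[unfolded mem_cubeQ, rule_format, of i] by auto
  have "((x - y)$i)\<^sup>2 \<le> 1" for i
    using power_mono[OF *[of i], of 2] by simp
  from this[of 1] this[of 2] this[of 3] have "(norm (x - y))\<^sup>2 \<le> 2\<^sup>2"
    unfolding norm_sq_3 by simp
  then show ?thesis unfolding dist_norm by (rule power2_le_imp_le) simp
qed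

text \<open>A full ball around a point of the cube may stick out of it; a corner cube of
  comparable size never does.\<close>

lemma corner_cube:
  assumes "p \<in> cubeQ" "0 \<le> \<rho>" "\<rho> \<le> 1/2"
  obtains C where "compact C" "C \<subseteq> cubeQ" "measure lebesgue C = \<rho>^3"
    "\<And>w. w \<in> C \<Longrightarrow> dist w p \<le> 2 * \<rho>"
proof -
  \<comment> \<open>In each coordinate the interval extends from \<open>p\<close> toward the farther
    face, so a side of at most 1/2 stays inside the cube.\<close>
  define l :: "real^3" where "l = (\<chi> i. if p$i \<le> 1/2 then p$i else p$i - \<rho>)"
  define C where "C = cbox l (l + (\<chi> i. \<rho>))"
  have l: "0 \<le> l$i" "l$i + \<rho> \<le> 1" "l$i \<le> p$i" "p$i \<le> l$i + \<rho>" for i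
    using assms(1)[unfolded mem_cubeQ, rule_format, of i] assms(2,3) by (auto simp: l_def)
  have C: "w \<in> C \<longleftrightarrow> (\<forall>i. l$i \<le> w$i \<and> w$i \<le> l$i + \<rho>)" for w
    by (auto simp: C_def mem_box_cart)
  show thesis
  proof
    show "compact C" by (simp add: C_def)
    show "C \<subseteq> cubeQ"
      using C l(1,2) order_trans unfolding mem_cubeQ subset_iff by meson
    have "l \<in> C" using C assms by auto
    then have "measure lebesgue C = prod (\<lambda>i::3. \<rho>) UNIV"
      unfolding C_def by (auto simp: content_cbox_if_cart)
    then show "measure lebesgue C = \<rho>^3" by simp
    fix w assume "w \<in> C"
    then have *: "\<bar>(w - p)$i\<bar> \<le> \<rho>" for i
      using C l[of i] by (auto simp: abs_le_iff) (smt (verit))+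
    have "((w - p)$i)\<^sup>2 \<le> \<rho>\<^sup>2" for i
      using power_mono[OF *[of i], of 2] by simp
    from this[of 1] this[of 2] this[of 3] have "(norm (w - p))\<^sup>2 \<le> 3 * \<rho>\<^sup>2"
      unfolding norm_sq_3 by linarith
    also have "\<dots> \<le> (2 * \<rho>)\<^sup>2" by (simp add: power2_eq_square)
    finally show "dist w p \<le> 2 * \<rho>"
      using assms(2) by (metis dist_norm mult_nonneg_nonneg power2_le_imp_le zero_le_numeral)
  qed
qed

section \<open>Integrability and comparison of energies\<close>

lemma integrable_on_lmeasurable_subset:
  fixes f :: "real^3 \<Rightarrow> 'b::euclidean_space"
  assumes "S \<in> sets lebesgue" "S \<subseteq> cubeQ" "continuous_on cubeQ f"
  shows "f integrable_on S"
  using set_integrable_subset[OF absolutely_integrable_continuous[OF assms(3)[unfolded cubeQ_def]] assms(1)]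
    assms(2) set_lebesgue_integral_eq_integral(1) unfolding cubeQ_def by blast

lemma continuous_infdist_sq: "continuous_on S (\<lambda>x. (infdist x Y)\<^sup>2)"
  by (intro continuous_intros)

lemma integrable_infdist_sq: "(\<lambda>x. (infdist x Y)\<^sup>2) integrable_on cubeQ"
  unfolding cubeQ_def by (intro integrable_continuous continuous_infdist_sq)

lemma infdist_sq_mono:
  "infdist x A \<le> infdist x B \<Longrightarrow> (infdist x A)\<^sup>2 \<le> (infdist x B)\<^sup>2"
  by (simp add: infdist_nonneg power_mono)

lemma energy_mono:
  assumes "\<And>x. x \<in> cubeQ \<Longrightarrow> infdist x A \<le> infdist x B"
  shows "energy A \<le> energy B"
  unfolding energy_def
  by (intro integral_le integrable_infdist_sq infdist_sq_mono assms)

text \<open>Common tool for local changes of a configuration: \<open>q\<close> bounds the change of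
  the squared distance where it matters, and a negative \<open>q\<close> expresses a gain.\<close>

lemma energy_le_add_integral:
  assumes "S \<in> sets lebesgue" "S \<subseteq> cubeQ" "continuous_on cubeQ q"
    and "\<And>x. x \<in> S \<Longrightarrow> (infdist x A)\<^sup>2 \<le> (infdist x B)\<^sup>2 + q x"
    and "\<And>x. x \<in> cubeQ - S \<Longrightarrow> infdist x A \<le> infdist x B"
  shows "energy A \<le> energy B + integral S q"
proof -
  have q: "q integrable_on S"
    by (rule integrable_on_lmeasurable_subset[OF assms(1-3)])
  have q': "(\<lambda>x. if x \<in> S then q x else 0) integrable_on cubeQ"
    using q assms(2) integrable_restrict_Int[of S q cubeQ] by (simp add: Int_absorb2)
  have "energy A \<le> integral cubeQ (\<lambda>x. (infdist x B)\<^sup>2 + (if x \<in> S then q x else 0))"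
    unfolding energy_def
    by (intro integral_le integrable_infdist_sq integrable_add q')
      (use assms(4) infdist_sq_mono[OF assms(5)] in auto)
  also have "\<dots> = energy B + integral S q"
    using assms(2) by (simp add: integral_add[OF integrable_infdist_sq q'] energy_def
      integral_restrict_Int Int_absorb2)
  finally show ?thesis .
qed

text \<open>Competitors may leave the cube and may have fewer points: projecting to the cube and
  adding points both decrease the energy.\<close>

lemma exists_subset_cubeQ_energy_le:
  assumes "finite Z" "Z \<noteq> {}" "card Z \<le> n"
  shows "\<exists>W. W \<subseteq> cubeQ \<and> finite W \<and> card W = n \<and> energy W \<le> energy Z"
proof -
  let ?p = "closest_point cubeQ"
  have ne: "cubeQ \<noteq> {}" using infinite_cubeQ by auto
  have le: "infdist x (?p ` Z) \<le> infdist x Z" if "x \<in> cubeQ" for x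
  proof -
    obtain z where z: "z \<in> Z" "infdist x Z = dist x z"
      using infdist_attains_inf[of Z x] assms(1,2) finite_imp_closed by blast
    have "infdist x (?p ` Z) \<le> dist x (?p z)" using z by (intro infdist_le) auto
    also have "\<dots> \<le> dist x z"
      using closest_point_lipschitz[OF convex_cubeQ closed_cubeQ ne, of x z] that
      by (simp add: closest_point_self)
    finally show ?thesis using z by simp
  qed
  have sub: "?p ` Z \<subseteq> cubeQ"
    using closest_point_in_set[OF closed_cubeQ ne] by auto
  have c: "card (?p ` Z) \<le> n" using card_image_le[OF assms(1), of ?p] assms(3) by simp
  have "infinite (cubeQ - ?p ` Z)" using infinite_cubeQ assms(1) by simp
  then obtain T where T: "T \<subseteq> cubeQ - ?p ` Z" "finite T" "card T = n - card (?p ` Z)"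
    using infinite_arbitrarily_large by metis
  have "card (?p ` Z \<union> T) = n"
    using T assms(1) c by (subst card_Un_disjoint) auto
  moreover have "energy (?p ` Z \<union> T) \<le> energy Z"
  proof (rule energy_mono)
    fix x assume "x \<in> cubeQ"
    then show "infdist x (?p ` Z \<union> T) \<le> infdist x Z"
      using le[of x] infdist_mono[of "?p ` Z" "?p ` Z \<union> T" x] assms(2) by auto
  qed
  ultimately show ?thesis using T sub assms(1) by (intro exI[of _ "?p ` Z \<union> T"]) auto
qed

lemma minimizer_energy_le:
  assumes "minimizer n Y" "finite Z" "Z \<noteq> {}" "card Z \<le> n"
  shows "energy Y \<le> energy Z"
  using exists_subset_cubeQ_energy_le[OF assms(2-4)] assms(1)
  unfolding minimizer_def by (meson order_trans)

section \<open>Voronoi cells and their volumes\<close>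

lemma voronoi_cell_subset: "voronoi_cell Y y \<subseteq> cubeQ"
  by (auto simp: voronoi_cell_def)

lemma compact_voronoi_cell: "compact (voronoi_cell Y y)"
proof -
  have "voronoi_cell Y y = cubeQ \<inter> (\<Inter>z\<in>Y. {x. dist x y \<le> dist x z})"
    by (auto simp: voronoi_cell_def)
  also have "compact \<dots>"
    by (intro compact_Int_closed compact_cubeQ closed_INT ballI closed_Collect_le continuous_intros)
  finally show ?thesis .
qed

lemma voronoi_cell_lmeasurable: "voronoi_cell Y y \<in> lmeasurable"
  by (simp add: compact_voronoi_cell lmeasurable_compact)

lemma voronoi_cell_sets: "voronoi_cell Y y \<in> sets lebesgue"
  using voronoi_cell_lmeasurable by blast

lemma infdist_voronoi_cell:
  assumes "x \<in> voronoi_cell Y y" "y \<in> Y"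
  shows "infdist x Y = dist x y"
proof (rule antisym)
  show "infdist x Y \<le> dist x y" using assms by (intro infdist_le)
  show "dist x y \<le> infdist x Y"
    using assms by (auto simp: infdist_def voronoi_cell_def intro!: cINF_greatest)
qed

lemma infdist_attained:
  fixes x :: "'a::heine_borel"
  assumes "finite Y" "Y \<noteq> {}"
  obtains y where "y \<in> Y" "infdist x Y = dist x y"
  using infdist_attains_inf[of Y x] assms finite_imp_closed by blast

lemma UN_voronoi_cell:
  assumes "finite Y" "Y \<noteq> {}"
  shows "(\<Union>y\<in>Y. voronoi_cell Y y) = cubeQ"
proof
  show "(\<Union>y\<in>Y. voronoi_cell Y y) \<subseteq> cubeQ" using voronoi_cell_subset by blast
  show "cubeQ \<subseteq> (\<Union>y\<in>Y. voronoi_cell Y y)"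
  proof
    fix x assume "x \<in> cubeQ"
    obtain y where "y \<in> Y" "infdist x Y = dist x y"
      using infdist_attained[OF assms] .
    then have "x \<in> voronoi_cell Y y"
      using \<open>x \<in> cubeQ\<close> by (auto simp: voronoi_cell_def) (metis infdist_le)
    with \<open>y \<in> Y\<close> show "x \<in> (\<Union>y\<in>Y. voronoi_cell Y y)" by blast
  qed
qed

text \<open>After squaring, \<open>x \<bullet> x\<close> cancels, so a Voronoi condition is a
  halfspace bounded by the bisector. This serves both the null overlaps of cells and the count of
  facets.\<close>

lemma dist_le_dist_iff:
  "dist x y \<le> dist x z \<longleftrightarrow> (z - y) \<bullet> x \<le> (z \<bullet> z - y \<bullet> y) / 2"
  for x :: "'a::real_inner"
proof -
  have "dist x y \<le> dist x z \<longleftrightarrow> (x - y) \<bullet> (x - y) \<le> (x - z) \<bullet> (x - z)"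
    by (simp add: dist_norm norm_le)
  then show ?thesis by (simp add: inner_diff inner_commute field_simps)
qed

lemma negligible_voronoi_cell_Int:
  assumes "y \<in> Y" "z \<in> Y" "y \<noteq> z"
  shows "negligible (voronoi_cell Y y \<inter> voronoi_cell Y z)"
proof (rule negligible_subset)
  show "negligible {x. (z - y) \<bullet> x = (z \<bullet> z - y \<bullet> y) / 2}"
    using assms by (intro negligible_hyperplane) auto
  show "voronoi_cell Y y \<inter> voronoi_cell Y z \<subseteq> {x. (z - y) \<bullet> x = (z \<bullet> z - y \<bullet> y) / 2}"
  proof
    fix x assume "x \<in> voronoi_cell Y y \<inter> voronoi_cell Y z"
    then have "dist x y \<le> dist x z" "dist x z \<le> dist x y"
      using assms by (auto simp: voronoi_cell_def)
    then show "x \<in> {x. (z - y) \<bullet> x = (z \<bullet> z - y \<bullet> y) / 2}"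
      unfolding dist_le_dist_iff by (simp add: inner_diff_left)
  qed
qed

lemma sum_measure_voronoi_cell:
  assumes "finite Y" "S \<subseteq> Y"
  shows "(\<Sum>y\<in>S. measure lebesgue (voronoi_cell Y y)) = measure lebesgue (\<Union>y\<in>S. voronoi_cell Y y)"
  using assms negligible_voronoi_cell_Int
  by (intro measure_negligible_finite_Union_image[symmetric] voronoi_cell_lmeasurable)
    (auto simp: pairwise_def finite_subset, blast)

lemma sum_measure_voronoi_cell_all:
  assumes "finite Y" "Y \<noteq> {}"
  shows "(\<Sum>y\<in>Y. measure lebesgue (voronoi_cell Y y)) = 1"
  using sum_measure_voronoi_cell[OF assms(1) order_refl] UN_voronoi_cell[OF assms] measure_cubeQ
  by simp

section \<open>Removing and adding points\<close>

text \<open>On a corner cube of side R/8 at \<open>x\<close> the new distance is at most R/4 and the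
  old one at least 3R/4. The square drops by at least R^2/2 on a set of volume R^3/512.\<close>

lemma energy_insert_far_point:
  assumes "Z \<noteq> {}" "x \<in> cubeQ" "0 \<le> R" "R \<le> 2" "R \<le> infdist x Z"
  shows "energy (insert x Z) \<le> energy Z - R^5 / 1024"
proof -
  obtain C where C: "compact C" "C \<subseteq> cubeQ" "measure lebesgue C = (R/8)^3"
    "\<And>w. w \<in> C \<Longrightarrow> dist w x \<le> 2 * (R/8)"
    using corner_cube[of x "R/8"] assms by auto
  have "energy (insert x Z) \<le> energy Z + integral C (\<lambda>_. - (R\<^sup>2/2))"
  proof (rule energy_le_add_integral)
    show "C \<in> sets lebesgue" using C(1) lmeasurable_compact by blast
    show "(infdist w (insert x Z))\<^sup>2 \<le> (infdist w Z)\<^sup>2 + - (R\<^sup>2/2)" if "w \<in> C" for w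
    proof -
      have 1: "dist w x \<le> R/4" using C(4)[OF that] by simp
      have "infdist w (insert x Z) \<le> R/4" using 1 infdist_le2[of x] by blast
      then have a: "(infdist w (insert x Z))\<^sup>2 \<le> (R/4)\<^sup>2"
        by (intro power_mono infdist_nonneg)
      have "3 * R/4 \<le> infdist w Z"
        using infdist_triangle[of x Z w] 1 assms(5) by (simp add: dist_commute)
      then have "(3 * R/4)\<^sup>2 \<le> (infdist w Z)\<^sup>2"
        using assms(3) by (intro power_mono) auto
      with a show ?thesis by (simp add: power2_eq_square)
    qed
    show "infdist w (insert x Z) \<le> infdist w Z" for w
      using assms(1) by (intro infdist_mono) auto
  qed (use C in auto)
  also have "integral C (\<lambda>_. - (R\<^sup>2/2)) = - (R\<^sup>2/2) * (R/8)^3"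
    using C(1,3) lmeasure_integral[of C] integral_mult_right[of C "- (R\<^sup>2/2)" "\<lambda>_. 1::real"]
    by (simp add: lmeasurable_compact)
  finally show ?thesis by (simp add: power2_eq_square power3_eq_cube power_divide eval_nat_numeral)
qed

text \<open>Parallel-axis identity: apart from its volume, \<open>S\<close> enters only through its
  first moment about \<open>y\<close>.\<close>

lemma integral_dist_sq_diff:
  fixes y z :: "real^3"
  assumes "S \<in> lmeasurable" "S \<subseteq> cubeQ"
  shows "integral S (\<lambda>x. (dist x z)\<^sup>2 - (dist x y)\<^sup>2)
    = (dist z y)\<^sup>2 * measure lebesgue S - 2 * ((z - y) \<bullet> integral S (\<lambda>x. x - y))"
proof -
  have i: "(\<lambda>x. x - y) integrable_on S"
    using assms by (intro integrable_on_lmeasurable_subset continuous_intros) auto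
  have eq: "(dist x z)\<^sup>2 - (dist x y)\<^sup>2 = (dist z y)\<^sup>2 * 1 - 2 * ((x - y) \<bullet> (z - y))" for x
    unfolding dist_norm power2_norm_eq_inner by (simp add: inner_diff inner_commute algebra_simps)
  have "integral S (\<lambda>x. (dist x z)\<^sup>2 - (dist x y)\<^sup>2) =
    integral S (\<lambda>x. (dist z y)\<^sup>2 * 1) - integral S (\<lambda>x. 2 * ((x - y) \<bullet> (z - y)))"
    unfolding eq
    using assms(1) i integrable_on_const[of S "(dist z y)\<^sup>2"]
      integrable_linear[OF i bounded_linear_inner_left[of "z - y"]]
    by (intro integral_diff integrable_on_cmult_left) (auto simp: o_def)
  also have "integral S (\<lambda>x. (dist z y)\<^sup>2 * 1) = (dist z y)\<^sup>2 * measure lebesgue S"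
    using lmeasure_integral[OF assms(1)] integral_mult_right[of S "(dist z y)\<^sup>2" "\<lambda>_. 1::real"] by simp
  also have "integral S (\<lambda>x. 2 * ((x - y) \<bullet> (z - y))) = 2 * (integral S (\<lambda>x. x - y) \<bullet> (z - y))"
    using integral_component_eq[OF i, of "z - y"] by simp
  finally show ?thesis by (simp add: inner_commute)
qed

text \<open>Only the cell of \<open>y\<close> is affected: inside it the moved point
  \<open>z\<close> is available, and outside it a nearest point of \<open>Y\<close> differs from
  \<open>y\<close> and survives.\<close>

lemma energy_move_point:
  assumes "finite Y" "y \<in> Y"
  shows "energy (insert z (Y - {y})) \<le> energy Y
    + integral (voronoi_cell Y y) (\<lambda>x. (dist x z)\<^sup>2 - (dist x y)\<^sup>2)"
proof (rule energy_le_add_integral)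
  show "voronoi_cell Y y \<in> sets lebesgue" by (rule voronoi_cell_sets)
  show "voronoi_cell Y y \<subseteq> cubeQ" by (rule voronoi_cell_subset)
  show "continuous_on cubeQ (\<lambda>x. (dist x z)\<^sup>2 - (dist x y)\<^sup>2)" by (intro continuous_intros)
  fix x
  show "(infdist x (insert z (Y - {y})))\<^sup>2 \<le> (infdist x Y)\<^sup>2 + ((dist x z)\<^sup>2 - (dist x y)\<^sup>2)"
    if "x \<in> voronoi_cell Y y"
    using infdist_voronoi_cell[OF that assms(2)] infdist_le[of z "insert z (Y - {y})" x]
    by (simp add: infdist_nonneg power_mono)
  show "infdist x (insert z (Y - {y})) \<le> infdist x Y" if x: "x \<in> cubeQ - voronoi_cell Y y"
  proof -
    obtain w where w: "w \<in> Y" "infdist x Y = dist x w"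
      using infdist_attained[of Y x] assms by auto
    have "w \<noteq> y"
    proof
      assume "w = y"
      then have "dist x y \<le> dist x z" if "z \<in> Y" for z
        using w infdist_le[OF that, of x] by simp
      then show False using x by (auto simp: voronoi_cell_def)
    qed
    then show ?thesis using w infdist_le[of w "insert z (Y - {y})" x] by simp
  qed
qed

text \<open>A minimizer is centroidal: shifting \<open>y\<close> slightly away from \<open>y'\<close> shows that the
  first-order term of moving \<open>y\<close> onto \<open>y'\<close> has a favourable sign.\<close>

lemma minimizer_energy_remove_point:
  assumes min: "minimizer n Y" and "y \<in> Y" "y' \<in> Y" "y' \<noteq> y"
  shows "energy (Y - {y}) \<le> energy Y + measure lebesgue (voronoi_cell Y y) * (dist y y')\<^sup>2"
proof -
  have fin: "finite Y" and card: "card Y = n" using min by (auto simp: minimizer_def)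
  define V where "V = voronoi_cell Y y"
  define v where "v = measure lebesgue V"
  define c where "c = (y' - y) \<bullet> integral V (\<lambda>x. x - y)"
  have move: "energy (insert (y + t *\<^sub>R (y' - y)) (Y - {y}))
      \<le> energy Y + (t\<^sup>2 * (dist y y')\<^sup>2 * v - 2 * t * c)" for t
  proof -
    have "(dist (y + t *\<^sub>R (y' - y)) y)\<^sup>2 = t\<^sup>2 * (dist y y')\<^sup>2"
      by (simp add: dist_norm power_mult_distrib norm_minus_commute)
    then show ?thesis
      using energy_move_point[OF fin assms(2), of "y + t *\<^sub>R (y' - y)", folded V_def]
        integral_dist_sq_diff[of V "y + t *\<^sub>R (y' - y)" y]
        voronoi_cell_lmeasurable[of Y y] voronoi_cell_subset[of Y y]
      by (simp add: V_def[symmetric] v_def[symmetric] c_def mult.assoc)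
  qed
  have "card (insert z (Y - {y})) \<le> n" for z
    using card fin assms(2) card_insert_le_m1[of n "Y - {y}" z] by (cases n) auto
  \<comment> \<open>The point \<open>z\<close> may lie outside the cube or belong to
    \<open>Y\<close>; \<open>minimizer_energy_le\<close> covers both cases.\<close>
  then have ge: "energy Y \<le> energy (insert z (Y - {y}))" for z
    using fin by (intro minimizer_energy_le[OF min]) auto
  \<comment> \<open>The competitor is \<open>move\<close> at \<open>-t\<close>. After division by
    \<open>t\<close>, letting \<open>t\<close> tend to 0 from the right leaves c \<ge> 0.\<close>
  have "0 \<le> t * (dist y y')\<^sup>2 * v + 2 * c" if "t > 0" for t
  proof -
    have "0 \<le> t * (t * (dist y y')\<^sup>2 * v + 2 * c)"
      using order_trans[OF ge move[of "-t"]] by (simp add: power2_eq_square algebra_simps)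
    then show ?thesis using that by (simp add: zero_le_mult_iff)
  qed
  then have "0 \<le> c"
  proof -
    have "((\<lambda>t. t * (dist y y')\<^sup>2 * v + 2 * c) \<longlongrightarrow> 0 * (dist y y')\<^sup>2 * v + 2 * c) (at_right 0)"
      by (intro tendsto_intros)
    then have "0 \<le> 0 * (dist y y')\<^sup>2 * v + 2 * c"
      by (rule tendsto_lowerbound)
        (auto simp: eventually_at_right_field intro!: exI[of _ 1] \<open>\<And>t. t > 0 \<Longrightarrow> 0 \<le> t * (dist y y')\<^sup>2 * v + 2 * c\<close>)
    then show ?thesis by simp
  qed
  \<comment> \<open>At t = 1 the point \<open>y\<close> lands on \<open>y'\<close>, which amounts to
    removing it, and the linear term -2c is at most 0.\<close>
  moreover have "insert y' (Y - {y}) = Y - {y}" using assms by auto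
  ultimately show ?thesis using move[of 1] by (simp add: V_def v_def mult.commute)
qed

section \<open>Covering radius of a minimizer\<close>

lemma minimizerD:
  assumes "minimizer n Y" "y \<in> Y"
  shows "finite Y" "card Y = n" "n > 0" "Y \<subseteq> cubeQ"
  using assms by (auto simp: minimizer_def card_gt_0_iff)

lemma nearest_other_point:
  assumes "finite Y" "card Y \<ge> 2" "y \<in> Y"
  obtains y' where "y' \<in> Y" "y' \<noteq> y" "\<And>z. z \<in> Y \<Longrightarrow> z \<noteq> y \<Longrightarrow> dist y y' \<le> dist y z"
proof -
  have "Y - {y} \<noteq> {}"
    using assms card_mono[of "{y}" Y] by auto
  then obtain y' where "y' \<in> Y - {y}" "\<And>z. z \<in> Y - {y} \<Longrightarrow> dist y y' \<le> dist y z"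
    using ex_is_arg_min_if_finite[of "Y - {y}" "dist y"] assms(1)
    by (auto simp: is_arg_min_linorder)
  then show thesis using that by auto
qed

text \<open>By the triangle inequality every other point is at least \<delta>/2 away from
  \<open>x\<close>. This turns nearest-neighbour distances into lower bounds for the size of a
  cell.\<close>

lemma half_nearest_mem_voronoi_cell:
  assumes "\<And>z. z \<in> Y \<Longrightarrow> z \<noteq> y \<Longrightarrow> \<delta> \<le> dist y z" "x \<in> cubeQ" "dist x y \<le> \<delta> / 2"
  shows "x \<in> voronoi_cell Y y"
  unfolding voronoi_cell_def
proof (intro CollectI conjI ballI assms(2))
  fix z assume "z \<in> Y"
  then show "dist x y \<le> dist x z"
    using assms(1)[of z] assms(3) dist_triangle[of y z x]
    by (cases "z = y") (auto simp: dist_commute)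
qed

text \<open>Some cell has volume at most \<open>1/n\<close>, and its inradius is controlled by its volume; so
  removing its point is cheap, while adding a point far from \<open>Y\<close> is profitable.\<close>

lemma minimizer_voronoi_radius:
  assumes min: "minimizer n Y" and "y \<in> Y" "x \<in> voronoi_cell Y y"
    and \<nu>: "0 \<le> \<nu>" "real n * \<nu>^3 = 1"
  shows "dist x y \<le> 7 * \<nu>"
proof -
  have fin: "finite Y" and card: "card Y = n" and sub: "Y \<subseteq> cubeQ" and n: "n > 0"
    using minimizerD[OF min \<open>y \<in> Y\<close>] by auto
  have xQ: "x \<in> cubeQ" using assms(3) by (auto simp: voronoi_cell_def)
  define R where "R = dist x y"
  have R: "infdist x Y = R" "0 \<le> R" "R \<le> 2"
    using infdist_voronoi_cell[OF assms(3,2)] dist_cubeQ_le_2[of x y] xQ sub assms(2)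
    by (auto simp: R_def)
  show ?thesis
  proof (cases "n = 1")
    \<comment> \<open>With a single point there is no other point to take over its cell, but then
      \<nu> \<ge> 1 and distances in the cube are at most 2.\<close>
    case True
    then have "1 \<le> \<nu>" using \<nu> by (metis mult_1 of_nat_1 power_less_one_iff linorder_not_less zero_less_numeral less_irrefl)
    then show ?thesis using R(3) by (simp add: R_def)
  next
    case False
    have "\<exists>y0\<in>Y. measure lebesgue (voronoi_cell Y y0) \<le> 1 / n"
    proof (rule ccontr)
      assume "\<not> ?thesis"
      then have "(\<Sum>y\<in>Y. 1 / real n) < (\<Sum>y\<in>Y. measure lebesgue (voronoi_cell Y y))"
        using fin assms(2) by (intro sum_strict_mono) (auto simp: not_le)
      moreover have "(\<Sum>y\<in>Y. measure lebesgue (voronoi_cell Y y)) = 1"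
        using fin assms(2) by (intro sum_measure_voronoi_cell_all) auto
      ultimately show False using card n by simp
    qed
    moreover have "\<nu>^3 = 1 / n" using \<nu>(2) n by (simp add: field_simps)
    ultimately obtain y0 where y0: "y0 \<in> Y" "measure lebesgue (voronoi_cell Y y0) \<le> \<nu>^3"
      by auto
    obtain y' where y': "y' \<in> Y" "y' \<noteq> y0" "\<And>z. z \<in> Y \<Longrightarrow> z \<noteq> y0 \<Longrightarrow> dist y0 y' \<le> dist y0 z"
      using nearest_other_point[OF fin _ y0(1)] card n False by auto
    define \<delta> where "\<delta> = dist y0 y'"
    have \<delta>: "0 \<le> \<delta>" "\<delta> \<le> 2" using dist_cubeQ_le_2 sub y0 y' by (auto simp: \<delta>_def)
    obtain C where C: "compact C" "C \<subseteq> cubeQ" "measure lebesgue C = (\<delta>/4)^3"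
      "\<And>w. w \<in> C \<Longrightarrow> dist w y0 \<le> 2 * (\<delta>/4)"
      using corner_cube[of y0 "\<delta>/4"] sub y0 \<delta> by auto
    \<comment> \<open>The cell contains a cube of side \<delta>/4, so its small volume forces
      \<delta> \<le> 4\<nu>.\<close>
    have "C \<subseteq> voronoi_cell Y y0"
      using C half_nearest_mem_voronoi_cell[of Y y0 \<delta>] y'(3) by (auto simp: \<delta>_def)
    then have "(\<delta>/4)^3 \<le> \<nu>^3"
      using C y0(2) measure_mono_fmeasurable[OF _ _ voronoi_cell_lmeasurable, of C Y y0]
        lmeasurable_compact[of C] by auto
    then have "\<delta>/4 \<le> \<nu>" using \<nu>(1) \<delta>(1) power_mono_iff[of "\<delta>/4" \<nu> 3] by simp
    then have "\<delta> \<le> 4 * \<nu>" by simp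
    then have "measure lebesgue (voronoi_cell Y y0) * \<delta>\<^sup>2 \<le> \<nu>^3 * (4 * \<nu>)\<^sup>2"
      using y0(2) \<delta>(1) \<nu>(1) by (intro mult_mono power_mono) auto
    also have "\<dots> = 16 * \<nu>^5" by (simp add: power2_eq_square eval_nat_numeral)
    finally have 1: "energy (Y - {y0}) \<le> energy Y + 16 * \<nu>^5"
      using minimizer_energy_remove_point[OF min y0(1) y'(1,2)] by (simp add: \<delta>_def)
    have ne: "Y - {y0} \<noteq> {}" using y' by auto
    have "R \<le> infdist x (Y - {y0})"
      using R(1) infdist_mono[of "Y - {y0}" Y x] ne by auto
    then have 2: "energy (insert x (Y - {y0})) \<le> energy (Y - {y0}) - R^5 / 1024"
      by (intro energy_insert_far_point ne xQ R)
    have "card (insert x (Y - {y0})) \<le> n"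
      using card fin y0(1) n card_insert_le_m1[of n "Y - {y0}" x] by auto
    then have "energy Y \<le> energy (insert x (Y - {y0}))"
      using fin by (intro minimizer_energy_le[OF min]) auto
    \<comment> \<open>Exchanging \<open>y0\<close> for \<open>x\<close> cannot lower the energy, so
      the gain R^5/1024 is at most the cost 16\<nu>^5. Here 16 * 1024 = 16384 lies just below 7^5 =
      16807, whence the radius 7.\<close>
    with 1 2 have "R^5 \<le> 16384 * \<nu>^5" by simp
    also have "\<dots> \<le> (7 * \<nu>)^5" using \<nu>(1) by (simp add: power_mult_distrib)
    finally show ?thesis using \<nu>(1) power_mono_iff[of R "7 * \<nu>" 5] R(2) by (simp add: R_def)
  qed
qed

section \<open>Gain of an additional point\<close>

lemma norm_axis_real: "norm (axis i c :: real^'n) = \<bar>c\<bar>"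
  by (simp add: norm_eq_sqrt_inner inner_axis_axis)

text \<open>Bathtub estimate with the two level sets \<open>r/2\<close> and \<open>3r/4\<close>; a single level would be too
  lossy for the constant \<open>Gamma3\<close>.\<close>

lemma integral_dist_ge:
  fixes y :: "real^3"
  assumes S: "S \<in> lmeasurable" "S \<subseteq> cubeQ" and r: "0 \<le> r" "omega3 * r^3 \<le> measure lebesgue S"
  shows "149/256 * r * measure lebesgue S \<le> integral S (\<lambda>x. dist x y)"
proof -
  define v where "v = measure lebesgue S"
  have ball: "ball y s \<inter> S \<in> lmeasurable" "measure lebesgue (ball y s \<inter> S) \<le> omega3 * s^3" if "0 \<le> s" for s
  proof -
    show 1: "ball y s \<inter> S \<in> lmeasurable" using S by (simp add: fmeasurable_Int_fmeasurable)
    show "measure lebesgue (ball y s \<inter> S) \<le> omega3 * s^3"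
      using measure_mono_fmeasurable[of "ball y s \<inter> S" "ball y s" lebesgue] 1 measure_ball_3(1)[OF that, of y]
      by auto
  qed
  have i: "(indicator (ball y s) :: _ \<Rightarrow> real) integrable_on S" if "0 \<le> s" for s
    using ball[OF that] by (simp add: integrable_on_indicator)
  \<comment> \<open>A step function below the distance: 0 in the inner ball, r/2 in the shell, 3r/4
    outside. The balls have at most 1/8 and 27/64 of the volume, and 3/4 - 1/16 - 27/256 =
    149/256.\<close>
  let ?f = "\<lambda>x. 3/4*r * 1 - r/2 * indicator (ball y (r/2)) x - r/4 * indicator (ball y (3/4*r)) x :: real"
  have c: "(\<lambda>x. c) integrable_on S" for c :: real using S by (intro integrable_on_const)
  have "integral S ?f \<le> integral S (\<lambda>x. dist x y)"
  proof (rule integral_le)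
    show "?f integrable_on S"
      using r c i[of "r/2"] i[of "3/4*r"] by (intro integrable_diff integrable_on_mult_right) auto
    show "(\<lambda>x. dist x y) integrable_on S"
      using S by (intro integrable_on_lmeasurable_subset continuous_intros) auto
    show "?f x \<le> dist x y" for x
      using r(1) by (auto simp: indicator_def dist_commute)
  qed
  moreover have "integral S ?f = 3/4*r * v
      - r/2 * measure lebesgue (ball y (r/2) \<inter> S) - r/4 * measure lebesgue (ball y (3/4*r) \<inter> S)"
  proof (rule integral_unique)
    have "((\<lambda>x. 1::real) has_integral v) S"
      using lmeasure_integral[OF S(1)] c[of 1] by (simp add: v_def has_integral_iff)
    moreover have "((indicator (ball y s) :: _ \<Rightarrow> real) has_integral measure lebesgue (ball y s \<inter> S)) S"
      if "0 \<le> s" for s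
      using i[OF that] ball(1)[OF that] by (simp add: has_integral_iff integral_indicator)
    ultimately show "(?f has_integral 3/4*r * v - r/2 * measure lebesgue (ball y (r/2) \<inter> S)
      - r/4 * measure lebesgue (ball y (3/4*r) \<inter> S)) S"
      using r(1) by (intro has_integral_diff has_integral_mult_right) auto
  qed
  moreover have "r/2 * measure lebesgue (ball y (r/2) \<inter> S) \<le> r/2 * (v/8)"
    using r ball[of "r/2"] by (intro mult_left_mono) (auto simp: v_def power_divide)
  moreover have "r/4 * measure lebesgue (ball y (3/4*r) \<inter> S) \<le> r/4 * (27/64 * v)"
    using r ball[of "3/4*r"] by (intro mult_left_mono) (auto simp: v_def power_mult_distrib power_divide)
  ultimately show ?thesis unfolding v_def[symmetric] by (simp add: algebra_simps)
qed

text \<open>The second argument of \<open>min\<close> is |x - y - u|^2 - |x - y|^2, and the 0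
  records that an added point never hurts. Gains outside the cell of \<open>y\<close> are
  ignored.\<close>

lemma energy_insert_le:
  assumes "y \<in> Z"
  shows "energy (insert (y + u) Z) \<le> energy Z
    + integral (voronoi_cell Z y) (\<lambda>x. min 0 ((norm u)\<^sup>2 - 2 * (u \<bullet> (x - y))))"
proof (rule energy_le_add_integral)
  show "voronoi_cell Z y \<in> sets lebesgue" by (rule voronoi_cell_sets)
  show "voronoi_cell Z y \<subseteq> cubeQ" by (rule voronoi_cell_subset)
  show "continuous_on cubeQ (\<lambda>x. min 0 ((norm u)\<^sup>2 - 2 * (u \<bullet> (x - y))))" by (intro continuous_intros)
  show mono: "infdist x (insert (y + u) Z) \<le> infdist x Z" for x
    using assms by (intro infdist_mono) auto
  show "(infdist x (insert (y + u) Z))\<^sup>2 \<le> (infdist x Z)\<^sup>2 + min 0 ((norm u)\<^sup>2 - 2 * (u \<bullet> (x - y)))"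
    if "x \<in> voronoi_cell Z y" for x
  proof -
    have "(infdist x (insert (y + u) Z))\<^sup>2 \<le> (dist x (y + u))\<^sup>2"
      by (intro power_mono infdist_le infdist_nonneg) auto
    also have "\<dots> = (dist x y)\<^sup>2 + ((norm u)\<^sup>2 - 2 * (u \<bullet> (x - y)))"
      unfolding dist_norm power2_norm_eq_inner by (simp add: inner_diff inner_add inner_commute algebra_simps)
    finally show ?thesis
      using infdist_sq_mono[OF mono, of x] infdist_voronoi_cell[OF that assms] by (simp add: min_def)
  qed
qed

text \<open>Six candidates for the new point are averaged: the shifts of \<open>y\<close> by \<open>a\<close> in the positive
  and negative coordinate directions, with \<open>a\<close> chosen optimally.\<close>

lemma exists_energy_insert_le:
  assumes "y \<in> Z" and r: "0 \<le> r" "omega3 * r^3 \<le> measure lebesgue (voronoi_cell Z y)"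
  shows "\<exists>z. energy (insert z Z) \<le> energy Z - 3/160 * r\<^sup>2 * measure lebesgue (voronoi_cell Z y)"
proof -
  define V where "V = voronoi_cell Z y"
  define v where "v = measure lebesgue V"
  have V: "V \<in> lmeasurable" "V \<subseteq> cubeQ"
    by (auto simp: V_def voronoi_cell_lmeasurable voronoi_cell_subset[THEN subsetD])
  \<comment> \<open>This \<open>a\<close> minimizes 3a^2 - 2a * (149/256) r, the averaged bound
    below up to a factor.\<close>
  define a where "a = 149/768 * r"
  have a: "0 \<le> a" using r by (simp add: a_def)
  define I where "I = {1, -1 :: real} \<times> (UNIV :: 3 set)"
  define u :: "real \<times> 3 \<Rightarrow> real^3" where "u p = axis (snd p) (fst p * a)" for p
  define q where "q p x = min 0 ((norm (u p))\<^sup>2 - 2 * (u p \<bullet> (x - y)))" for p x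
  have q: "q p integrable_on V" for p
    unfolding q_def using V by (intro integrable_on_lmeasurable_subset continuous_intros) auto
  have I: "finite I" "card I = 6" by (auto simp: I_def card_cartesian_product)
  have sum_q: "(\<Sum>p\<in>I. q p x) \<le> 3 * a\<^sup>2 * 1 - 2 * a * dist x y" for x
  proof -
    have u: "(norm (u (s, i)))\<^sup>2 = a\<^sup>2" "u (s, i) \<bullet> (x - y) = s * (a * (x - y) $ i)" if "s \<in> {1, -1}" for s i
      using that by (auto simp: u_def inner_axis' norm_axis_real)
    have "(\<Sum>p\<in>I. q p x) = (\<Sum>s\<in>{1, -1}. \<Sum>i\<in>UNIV. q (s, i) x)"
      unfolding I_def sum.cartesian_product by (intro sum.cong) auto
    also have "\<dots> = (\<Sum>i\<in>UNIV. q (1, i) x + q (-1, i) x)"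
      by (simp add: sum.distrib)
    \<comment> \<open>For each axis only the shift toward \<open>x\<close> is used, the opposite one
      contributing at most 0. The absolute coordinates then add up to at least the Euclidean
      distance.\<close>
    also have "\<dots> \<le> (\<Sum>i\<in>UNIV. a\<^sup>2 - 2 * a * \<bar>(x - y) $ i\<bar>)"
    proof (rule sum_mono)
      fix i :: 3
      let ?t = "a * (x - y) $ i"
      have "q (1, i) x + q (-1, i) x \<le> a\<^sup>2 - 2 * \<bar>?t\<bar>"
        unfolding q_def using u[of 1 i] u[of "-1" i] by (simp add: min_def abs_if)
      then show "q (1, i) x + q (-1, i) x \<le> a\<^sup>2 - 2 * a * \<bar>(x - y) $ i\<bar>"
        using a by (simp add: abs_mult)
    qed
    also have "\<dots> = 3 * a\<^sup>2 - 2 * a * (\<Sum>i\<in>UNIV. \<bar>(x - y) $ i\<bar>)"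
      by (simp add: sum_subtractf sum_distrib_left)
    also have "\<dots> \<le> 3 * a\<^sup>2 - 2 * a * dist x y"
      using norm_le_l1_cart[of "x - y"] a unfolding dist_norm by (intro diff_mono mult_left_mono) auto
    finally show ?thesis by simp
  qed
  have d: "(\<lambda>x. dist x y) integrable_on V"
    using V by (intro integrable_on_lmeasurable_subset continuous_intros) auto
  have c: "(\<lambda>x. c) integrable_on V" for c :: real using V by (intro integrable_on_const)
  have "(\<Sum>p\<in>I. integral V (q p)) = integral V (\<lambda>x. \<Sum>p\<in>I. q p x)"
    using q I by (intro integral_sum[symmetric]) auto
  also have "\<dots> \<le> integral V (\<lambda>x. 3 * a\<^sup>2 * 1 - 2 * a * dist x y)"
    using sum_q q I d c by (intro integral_le integrable_sum integrable_diff integrable_on_mult_right) auto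
  also have "\<dots> = 3 * a\<^sup>2 * v - 2 * a * integral V (\<lambda>x. dist x y)"
  proof (rule integral_unique)
    have "((\<lambda>x. 1::real) has_integral v) V"
      using lmeasure_integral[OF V(1)] c[of 1] by (simp add: v_def has_integral_iff)
    then show "((\<lambda>x. 3 * a\<^sup>2 * 1 - 2 * a * dist x y) has_integral
        3 * a\<^sup>2 * v - 2 * a * integral V (\<lambda>x. dist x y)) V"
      using d by (intro has_integral_diff has_integral_mult_right integrable_integral)
  qed
  also have "\<dots> \<le> 3 * a\<^sup>2 * v - 2 * a * (149/256 * r * v)"
    using integral_dist_ge[OF V r(1), of y] r a
    by (intro diff_left_mono mult_left_mono) (auto simp: v_def V_def)
  also have "\<dots> = - (149/768)\<^sup>2 * 3 * (r\<^sup>2 * v)"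
    by (simp add: a_def power2_eq_square field_simps)
  \<comment> \<open>Rounding: 3 * (149/768)^2 is about 0.1129, slightly above 18/160 =
    0.1125.\<close>
  also have "\<dots> \<le> - (6 * (3/160)) * (r\<^sup>2 * v)"
    by (intro mult_right_mono) (auto simp: v_def power2_eq_square)
  finally have total: "(\<Sum>p\<in>I. integral V (q p)) \<le> - (6 * (3/160)) * (r\<^sup>2 * v)" .
  have "\<exists>p\<in>I. integral V (q p) \<le> - (3/160) * (r\<^sup>2 * v)"
  proof (rule ccontr)
    assume "\<not> ?thesis"
    then have "(\<Sum>p\<in>I. - (3/160) * (r\<^sup>2 * v)) < (\<Sum>p\<in>I. integral V (q p))"
      using I by (intro sum_strict_mono) (auto simp: not_le)
    then show False using total I by (simp add: mult.commute)
  qed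
  then obtain p where "integral V (q p) \<le> - (3/160) * (r\<^sup>2 * v)" by blast
  then have "energy (insert (y + u p) Z) \<le> energy Z - 3/160 * r\<^sup>2 * v"
    using energy_insert_le[OF assms(1), of "u p"] by (simp add: q_def[abs_def] V_def)
  then show ?thesis by (auto simp: v_def V_def)
qed

text \<open>The cells have mean volume \<open>1 / card Z\<close>, so at least one is large enough
  for \<open>exists_energy_insert_le\<close>.\<close>

lemma exists_energy_decrease:
  assumes "finite Z" "Z \<noteq> {}" and r: "0 \<le> r" "real (card Z) * (omega3 * r^3) \<le> 1"
  shows "\<exists>z. energy (insert z Z) \<le> energy Z - 3/160 * omega3 * r^5"
proof -
  have "\<exists>y\<in>Z. omega3 * r^3 \<le> measure lebesgue (voronoi_cell Z y)"
  proof (rule ccontr)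
    assume "\<not> ?thesis"
    then have "(\<Sum>y\<in>Z. measure lebesgue (voronoi_cell Z y)) < (\<Sum>y\<in>Z. omega3 * r^3)"
      using assms(1,2) by (intro sum_strict_mono) (auto simp: not_le)
    then show False using sum_measure_voronoi_cell_all[OF assms(1,2)] r(2) by simp
  qed
  then obtain y where y: "y \<in> Z" "omega3 * r^3 \<le> measure lebesgue (voronoi_cell Z y)" by blast
  obtain z where z: "energy (insert z Z) \<le> energy Z - 3/160 * r\<^sup>2 * measure lebesgue (voronoi_cell Z y)"
    using exists_energy_insert_le[OF y(1) r(1) y(2)] by blast
  have "3/160 * r\<^sup>2 * (omega3 * r^3) \<le> 3/160 * r\<^sup>2 * measure lebesgue (voronoi_cell Z y)"
    by (intro mult_left_mono y) auto
  moreover have "3/160 * r\<^sup>2 * (omega3 * r^3) = 3/160 * omega3 * r^5"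
    by (simp add: eval_nat_numeral)
  ultimately show ?thesis using z by (intro exI[of _ z]) simp
qed

section \<open>Consequences of minimality and the size of a single cell\<close>

text \<open>Delete \<open>y\<close>, then add a point where it gains most: the gain of the addition
  cannot exceed the cost of the removal. Both lower bounds on cells start from this
  inequality.\<close>

lemma minimizer_cell_mass_ge:
  assumes min: "minimizer n Y" and y: "y \<in> Y" "y' \<in> Y" "y' \<noteq> y"
    and \<rho>: "0 \<le> \<rho>" "real n * (omega3 * \<rho>^3) = 1"
  shows "3/160 * omega3 * \<rho>^5 \<le> measure lebesgue (voronoi_cell Y y) * (dist y y')\<^sup>2"
proof -
  have Y: "finite Y" "card Y = n" "n > 0" using minimizerD[OF min y(1)] by auto
  have "real (card (Y - {y})) * (omega3 * \<rho>^3) \<le> real n * (omega3 * \<rho>^3)"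
    using Y y \<rho> omega3_bounds by (intro mult_right_mono) auto
  then obtain z where z: "energy (insert z (Y - {y})) \<le> energy (Y - {y}) - 3/160 * omega3 * \<rho>^5"
    using exists_energy_decrease[of "Y - {y}" \<rho>] Y y \<rho> by auto
  have "card (insert z (Y - {y})) \<le> n"
    using Y y card_insert_le_m1[of n "Y - {y}" z] by auto
  then have "energy Y \<le> energy (insert z (Y - {y}))"
    using Y by (intro minimizer_energy_le[OF min]) auto
  with z minimizer_energy_remove_point[OF min y] show ?thesis by simp
qed

text \<open>Elementary substitute for the isodiametric inequality: \<open>V\<close> lies in an
  axis-parallel cube with lower corner at the coordinatewise infima.\<close>

lemma measure_le_diameter_cube:
  fixes V :: "(real^3) set"
  assumes "compact V"
  shows "measure lebesgue V \<le> (diameter V)^3"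
proof (cases "V = {}")
  case False
  have b: "bounded V" using assms by (rule compact_imp_bounded)
  have D: "\<bar>x$i - x'$i\<bar> \<le> diameter V" if "x \<in> V" "x' \<in> V" for x x' i
    using diameter_bounded_bound[OF b that] component_le_norm_cart[of "x - x'" i]
    by (simp add: dist_norm)
  define l :: "real^3" where "l = (\<chi> i. Inf ((\<lambda>x. x$i) ` V))"
  have bdd: "bdd_below ((\<lambda>x. x$i) ` V)" for i
    using bounded_component_cart[OF b, of i] by (simp add: bounded_imp_bdd_below image_def) 
  have le: "l$i \<le> x$i" "x$i \<le> l$i + diameter V" if "x \<in> V" for x i
  proof -
    show "l$i \<le> x$i" using bdd that by (auto simp: l_def intro: cInf_lower)
    have "x$i - diameter V \<le> l$i"
      unfolding l_def vec_lambda_beta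
    proof (rule cInf_greatest)
      show "(\<lambda>x. x$i) ` V \<noteq> {}" using False by simp
      fix t assume "t \<in> (\<lambda>x. x$i) ` V"
      then obtain x' where "x' \<in> V" "t = x'$i" by blast
      then show "x$i - diameter V \<le> t" using D[OF that, of x' i] by (simp add: abs_le_iff)
    qed
    then show "x$i \<le> l$i + diameter V" by simp
  qed
  let ?B = "cbox l (l + (\<chi> i. diameter V))"
  have sub: "V \<subseteq> ?B" using le by (auto simp: mem_box_cart)
  then have "measure lebesgue V \<le> measure lebesgue ?B"
    using assms by (intro measure_mono_fmeasurable) (auto dest: lmeasurable_compact)
  also have "\<dots> = (diameter V)^3"
    using sub False by (auto simp: content_cbox_if_cart)
  finally show ?thesis .
qed (simp add: diameter_def)

text \<open>From \<open>y\<close> one can move inside the cube by \<open>h\<close> along two different axes.\<close>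

lemma voronoi_cell_diameter_sq_ge:
  assumes "y \<in> cubeQ" "\<And>z. z \<in> Y \<Longrightarrow> z \<noteq> y \<Longrightarrow> \<delta> \<le> dist y z" "0 \<le> h" "h \<le> 1/2" "h \<le> \<delta>/2"
  shows "2 * h\<^sup>2 \<le> (diameter (voronoi_cell Y y))\<^sup>2"
proof -
  define s where "s i = (if y$i \<le> 1/2 then h else - h)" for i
  define p where "p i = y + axis i (s i)" for i
  have s: "\<bar>s i\<bar> = h" for i using assms(3) by (simp add: s_def)
  have pQ: "p i \<in> cubeQ" for i
    unfolding mem_cubeQ
  proof
    fix j show "0 \<le> p i $ j \<and> p i $ j \<le> 1"
      using assms(1)[unfolded mem_cubeQ, rule_format, of j] assms(3,4)
      by (cases "i = j") (auto simp: p_def s_def axis_def)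
  qed
  have "p i \<in> voronoi_cell Y y" for i
    using assms(2,5) s[of i]
    by (intro half_nearest_mem_voronoi_cell[OF _ pQ]) (auto simp: p_def dist_norm norm_axis_real)
  then have "dist (p 1) (p 2) \<le> diameter (voronoi_cell Y y)"
    by (intro diameter_bounded_bound compact_imp_bounded compact_voronoi_cell)
  then have "(dist (p 1) (p 2))\<^sup>2 \<le> (diameter (voronoi_cell Y y))\<^sup>2"
    by (intro power_mono) auto
  moreover have "(dist (p 1) (p 2))\<^sup>2 = 2 * h\<^sup>2"
    using s[of 1] s[of 2] unfolding dist_norm norm_sq_3
    by (simp add: p_def axis_def power2_abs[symmetric, of "s _"])
  ultimately show ?thesis by simp
qed

section \<open>Faces of Voronoi cells\<close>

text \<open>\<open>facet_of_polyhedron_explicit\<close> needs an irredundant family of halfspaces; recording a facet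
  by the frontier of its halfspace makes the conclusion independent of the subfamily chosen.\<close>

lemma facet_of_Inter_halfspaces:
  fixes F :: "'a::euclidean_space set set"
  assumes fin: "finite F" and S: "S = \<Inter>F"
    and half: "\<And>h. h \<in> F \<Longrightarrow> \<exists>a b. a \<noteq> 0 \<and> h = {x. a \<bullet> x \<le> b}"
    and facet: "C facet_of S"
  shows "\<exists>h\<in>F. C = S \<inter> frontier h"
proof -
  obtain a b where ab: "\<And>h. h \<in> F \<Longrightarrow> a h \<noteq> 0 \<and> h = {x. a h \<bullet> x \<le> b h}"
    using half by metis
  let ?good = "\<lambda>G. G \<subseteq> F \<and> S = affine hull S \<inter> \<Inter>G"
  have "?good F" using S hull_subset[of S affine] by auto
  then obtain G where G: "?good G" and least: "\<And>G'. ?good G' \<Longrightarrow> card G \<le> card G'"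
    using ex_has_least_nat[of ?good F card] by blast
  have fG: "finite G" using G fin finite_subset by blast
  have "S \<subset> affine hull S \<inter> \<Inter>G'" if "G' \<subset> G" for G'
  proof -
    have "S \<subseteq> affine hull S \<inter> \<Inter>G'" using G that by blast
    moreover have "S \<noteq> affine hull S \<inter> \<Inter>G'"
      using least[of G'] psubset_card_mono[OF fG that] that G by auto
    ultimately show ?thesis by blast
  qed
  then have "C facet_of S \<longleftrightarrow> (\<exists>h. h \<in> G \<and> C = S \<inter> {x. a h \<bullet> x = b h})"
    using G ab by (intro facet_of_polyhedron_explicit fG) auto
  then obtain h where h: "h \<in> G" "C = S \<inter> {x. a h \<bullet> x = b h}" using facet by blast
  have "h \<in> F" using h G by blast
  moreover have "frontier h = {x. a h \<bullet> x = b h}"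
    using ab[OF \<open>h \<in> F\<close>] frontier_halfspace_le[of "a h" "b h"] by metis
  ultimately show ?thesis using h by auto
qed

text \<open>The cell is cut out by six halfspaces of the cube and the bisector halfspaces. A facet
  is nonempty, so one on a bisector supplies a point equidistant from \<open>y\<close> and
  \<open>z\<close>.\<close>

lemma card_facets_voronoi_cell_le:
  assumes "finite Y" "y \<in> Y"
  shows "card {C. C facet_of voronoi_cell Y y}
    \<le> 6 + card {z \<in> Y - {y}. \<exists>x\<in>voronoi_cell Y y. dist x y = dist x z}"
proof -
  define V where "V = voronoi_cell Y y"
  define N where "N = {z \<in> Y - {y}. \<exists>x\<in>V. dist x y = dist x z}"
  define lo where "lo i = {x::real^3. - axis i 1 \<bullet> x \<le> 0}" for i
  define hi where "hi i = {x::real^3. axis i 1 \<bullet> x \<le> 1}" for i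
  define bi where "bi z = {x. (z - y) \<bullet> x \<le> (z \<bullet> z - y \<bullet> y) / 2}" for z
  define F where "F = range lo \<union> range hi \<union> bi ` (Y - {y})"
  have finF: "finite F" using assms by (simp add: F_def)
  have VF: "V = \<Inter>F"
  proof (rule set_eqI)
    fix x
    have "x \<in> \<Inter>F \<longleftrightarrow> x \<in> cubeQ \<and> (\<forall>z\<in>Y - {y}. x \<in> bi z)"
      by (auto simp: F_def lo_def hi_def mem_cubeQ inner_axis')
    also have "\<dots> \<longleftrightarrow> x \<in> V"
      unfolding V_def voronoi_cell_def bi_def dist_le_dist_iff[symmetric] by auto
    finally show "x \<in> V \<longleftrightarrow> x \<in> \<Inter>F" by simp
  qed
  have half: "\<exists>a b. a \<noteq> 0 \<and> h = {x. a \<bullet> x \<le> b}" if "h \<in> F" for h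
  proof -
    have ax: "axis i (1::real) \<noteq> (0::real^3)" for i by (simp add: axis_eq_0_iff)
    from that show ?thesis unfolding F_def
    proof (elim UnE imageE)
      fix i assume "h = lo i"
      then show ?thesis using ax[of i] unfolding lo_def
        by (intro exI[of _ "- axis i 1"] exI[of _ 0]) simp
    next
      fix i assume "h = hi i"
      then show ?thesis using ax[of i] unfolding hi_def
        by (intro exI[of _ "axis i 1"] exI[of _ 1]) simp
    next
      fix z assume "h = bi z" "z \<in> Y - {y}"
      then show ?thesis unfolding bi_def
        by (intro exI[of _ "z - y"] exI[of _ "(z \<bullet> z - y \<bullet> y) / 2"]) simp
    qed
  qed
  let ?g = "\<lambda>h. V \<inter> frontier h"
  let ?A = "?g ` range lo \<union> ?g ` range hi" and ?B = "(\<lambda>z. ?g (bi z)) ` N"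
  have "{C. C facet_of V} \<subseteq> ?A \<union> ?B"
  proof
    fix C assume "C \<in> {C. C facet_of V}"
    then have C: "C facet_of V" by simp
    then obtain h where h: "h \<in> F" "C = ?g h"
      using facet_of_Inter_halfspaces[OF finF VF half] by blast
    have "C \<noteq> {}" using C by (simp add: facet_of_def)
    show "C \<in> ?A \<union> ?B"
    proof (cases "h \<in> range lo \<union> range hi")
      case False
      then obtain z where z: "z \<in> Y - {y}" "h = bi z" using h by (auto simp: F_def)
      have "frontier (bi z) = {x. (z - y) \<bullet> x = (z \<bullet> z - y \<bullet> y) / 2}"
        unfolding bi_def using z by (intro frontier_halfspace_le) auto
      moreover obtain x where "x \<in> V" "x \<in> frontier (bi z)" using \<open>C \<noteq> {}\<close> h z by auto
      ultimately have "dist x y = dist x z"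
        using dist_le_dist_iff[of x y z] dist_le_dist_iff[of x z y] by (simp add: inner_diff_left)
      then have "z \<in> N" using z \<open>x \<in> V\<close> by (auto simp: N_def)
      then show ?thesis using h z by auto
    qed (use h in auto)
  qed
  moreover have finN: "finite N" using assms by (simp add: N_def)
  ultimately have "card {C. C facet_of V} \<le> card (?A \<union> ?B)"
    by (intro card_mono) auto
  also have "\<dots> \<le> card ?A + card ?B" by (rule card_Un_le)
  also have "card ?A \<le> card (?g ` range lo) + card (?g ` range hi)" by (rule card_Un_le)
  also have "card (?g ` range lo) \<le> 3"
    unfolding image_image using card_image_le[of UNIV "\<lambda>i. ?g (lo i)"] by simp
  also have "card (?g ` range hi) \<le> 3"
    unfolding image_image using card_image_le[of UNIV "\<lambda>i. ?g (hi i)"] by simp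
  also have "card ?B \<le> card N" by (rule card_image_le[OF finN])
  finally show ?thesis by (simp add: V_def N_def)
qed

text \<open>Packing argument: a neighbour is within 2R of \<open>y\<close> through a common
  equidistant point, so its cell lies in the ball of radius 3R. The added 1 counts the cell of
  \<open>y\<close> itself.\<close>

lemma card_neighbours_mult_le:
  assumes "finite Y" "y \<in> Y" and R: "0 \<le> R" "\<And>z x. z \<in> Y \<Longrightarrow> x \<in> voronoi_cell Y z \<Longrightarrow> dist x z \<le> R"
    and v: "\<And>z. z \<in> Y \<Longrightarrow> v \<le> measure lebesgue (voronoi_cell Y z)"
  defines "N \<equiv> {z \<in> Y - {y}. \<exists>x\<in>voronoi_cell Y y. dist x y = dist x z}"
  shows "real (card N + 1) * v \<le> omega3 * (3 * R)^3"
proof -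
  let ?V = "voronoi_cell Y"
  have N: "finite N" "y \<notin> N" "insert y N \<subseteq> Y" using assms by (auto simp: N_def)
  have "real (card N + 1) * v = (\<Sum>z\<in>insert y N. v)" using N by simp
  also have "\<dots> \<le> (\<Sum>z\<in>insert y N. measure lebesgue (?V z))"
    using v N by (intro sum_mono) blast
  also have "\<dots> = measure lebesgue (\<Union>z\<in>insert y N. ?V z)"
    by (rule sum_measure_voronoi_cell[OF assms(1) N(3)])
  also have "\<dots> \<le> measure lebesgue (cball y (3 * R))"
  proof (rule measure_mono_fmeasurable)
    show "(\<Union>z\<in>insert y N. ?V z) \<subseteq> cball y (3 * R)"
    proof
      fix x assume "x \<in> (\<Union>z\<in>insert y N. ?V z)"
      then obtain z where z: "z \<in> insert y N" "x \<in> ?V z" by blast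
      have "dist y z \<le> 2 * R"
      proof (cases "z = y")
        case False
        then obtain w where "w \<in> ?V y" "dist w y = dist w z" using z by (auto simp: N_def)
        then show ?thesis using R(2)[OF assms(2), of w] dist_triangle[of y z w]
          by (simp add: dist_commute)
      qed (use R in auto)
      moreover have "dist x z \<le> R" using R(2) z N by blast
      ultimately show "x \<in> cball y (3 * R)"
        using dist_triangle[of y x z] by (simp add: dist_commute)
    qed
    show "(\<Union>z\<in>insert y N. ?V z) \<in> sets lebesgue"
      using N by (intro sets.finite_UN voronoi_cell_sets) auto
  qed auto
  also have "\<dots> = omega3 * (3 * R)^3" using R(1) measure_ball_3(2)[of "3 * R" y] by simp
  finally show ?thesis .
qed

section \<open>Constants and the bounds on cells\<close>

text \<open>Cubing here, and taking fifth powers for \<open>Gamma3\<close>, removes the fractional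
  exponents, so that later comparisons are polynomial.\<close>

lemma Gamma1_pos: "0 < Gamma1" and Gamma1_cube: "Gamma1^3 = 1/400000"
  by (auto simp: Gamma1_def power_divide powr_power)

lemma Gamma3_pos: "0 < Gamma3" and Gamma3_pow5: "Gamma3^5 * omega3 = Gamma1"
proof -
  show "0 < Gamma3" using omega3_bounds Gamma1_pos by (simp add: Gamma3_def)
  have "(omega3 powr (-1/5))^5 = 1 / omega3" "(Gamma1 powr (1/5))^5 = Gamma1"
    using omega3_bounds Gamma1_pos by (subst powr_power; simp add: powr_neg_one)+
  then show "Gamma3^5 * omega3 = Gamma1"
    using omega3_bounds by (simp add: Gamma3_def power_mult_distrib)
qed

lemma Gamma3_le: "Gamma3 \<le> 1/2"
proof -
  have "Gamma1^3 \<le> (1/40)^3" by (simp add: Gamma1_cube power_divide)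
  then have "Gamma1 \<le> 1/40" using Gamma1_pos by (simp add: power_mono_iff)
  moreover have "Gamma3^5 * 4 \<le> Gamma3^5 * omega3"
    using Gamma3_pos omega3_bounds by (intro mult_left_mono) auto
  ultimately have "Gamma3^5 \<le> (1/2)^5" using Gamma3_pow5 by (simp add: power_divide)
  then show ?thesis using Gamma3_pos by (simp add: power_mono_iff)
qed

lemma sqrtterm_pos: "0 < sqrtterm" and sqrtterm_le: "sqrtterm \<le> 1/100"
proof -
  show "0 < sqrtterm" unfolding sqrtterm_def by simp
  have "sqrt (1 + 2^4 * 3^3 / (5^2 * 10^3)) \<le> 101/100" by (rule real_le_lsqrt) (auto simp: power2_eq_square)
  then show "sqrtterm \<le> 1/100" unfolding sqrtterm_def by simp
qed

lemma Gamma5_pos: "0 < Gamma5" and Gamma5_le: "Gamma5 \<le> 1/800"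
proof -
  show "0 < Gamma5" using sqrtterm_pos Gamma3_pos by (simp add: Gamma5_def)
  have "sqrtterm * Gamma3 \<le> 1/100 * (1/2)"
    using sqrtterm_pos sqrtterm_le Gamma3_pos Gamma3_le by (intro mult_mono) auto
  then show "Gamma5 \<le> 1/800" by (simp add: Gamma5_def mult.commute)
qed

text \<open>The covering radius 7\<nu> yields diameters up to 14\<nu>. Comparing each base with a
  perfect power bounds the three factors below by 1, 10 and 3.\<close>

lemma Gamma4_ge: "14 \<le> Gamma4"
proof -
  have powr_eq: "(b^k) powr (1 / real k) = b" if "b > 0" "k > 0" for b :: real and k
    using that by (simp add: powr_powr flip: powr_realpow)
  have "pi powr (1/4) \<le> (2^4) powr (1/4)"
    using pi_less_4 by (intro powr_mono2) auto
  moreover have "omega3 powr (1/12) \<le> (2^12) powr (1/12)"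
    using omega3_bounds by (intro powr_mono2) auto
  ultimately have "pi powr (1/4) * omega3 powr (1/12) \<le> 2 * 2"
    using powr_eq[of 2 4] powr_eq[of 2 12] by (intro mult_mono) auto
  moreover have "1 \<le> 12 powr (1/4 :: real)" by (simp add: ge_one_powr_ge_zero)
  moreover have "(2^3) powr (1/3) \<le> (16 :: real) powr (1/3)" by (intro powr_mono2) auto
  then have "2 \<le> (16 :: real) powr (1/3)" using powr_eq[of 2 3] by simp
  ultimately have A: "1 \<le> (2 * 12 powr (1/4) * 16 powr (1/3)) / (pi powr (1/4) * omega3 powr (1/12))"
    using omega3_bounds mult_mono[of 1 "12 powr (1/4 :: real)" 2 "16 powr (1/3)"]
    by (simp add: le_divide_eq)
  have "((1/10)^2) powr (-1/2) \<le> sqrtterm powr (-1/2)"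
    using sqrtterm_pos sqrtterm_le by (intro powr_mono2') (auto simp: power2_eq_square)
  then have B: "10 \<le> sqrtterm powr (-1/2)"
    using powr_eq[of "1/10" 2] by (simp add: powr_minus_divide)
  have "(3^4) powr (1/4) \<le> ((5^2 * 10^3) / (2^2 * 3^3) :: real) powr (1/4)"
    by (intro powr_mono2) auto
  then have C: "3 \<le> ((5^2 * 10^3) / (2^2 * 3^3) :: real) powr (1/4)"
    using powr_eq[of 3 4] by simp
  have "14 \<le> 1 * 10 * (3::real)" by simp
  also have "\<dots> \<le> Gamma4"
    unfolding Gamma4_def using A B C by (intro mult_mono) auto
  finally show ?thesis .
qed

text \<open>A cube of side \<nu> and a ball of radius \<rho> both have volume 1/n; the polynomial
  relations replace \<open>powr\<close> in the estimates.\<close>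

lemma length_scales:
  assumes "n > 0"
  obtains \<nu> \<rho> where "\<nu> = real n powr (-1/3)" "0 < \<nu>" "real n * \<nu>^3 = 1"
    "\<rho> = \<nu> * omega3 powr (-1/3)" "0 < \<rho>" "omega3 * \<rho>^3 = \<nu>^3"
proof -
  define \<nu> \<rho> where "\<nu> = real n powr (-1/3)" and "\<rho> = \<nu> * omega3 powr (-1/3)"
  have "(x powr (-1/3))^3 = 1 / x" if "x > 0" for x :: real
    using that by (subst powr_power) (auto simp: powr_neg_one)
  from this[of "real n"] this[of omega3] have "real n * \<nu>^3 = 1" "omega3 * \<rho>^3 = \<nu>^3"
    using assms omega3_bounds by (auto simp: \<nu>_def \<rho>_def power_mult_distrib)
  moreover have "0 < \<nu>" "0 < \<rho>" using assms omega3_bounds by (auto simp: \<nu>_def \<rho>_def)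
  ultimately show thesis using that[of \<nu> \<rho>] \<nu>_def \<rho>_def by simp
qed

text \<open>After multiplication by \<open>omega3\<close> and cubing, this reduces to
  \<open>Gamma1^3\<close> \<le> (3/320)^3 * \<open>omega3\<close>, for which \<open>omega3\<close> >
  4 suffices. The constant is half of 3/160, the factor 2 being lost in \<delta>^2 \<le>
  2D^2.\<close>

lemma Gamma3_pow5_le:
  assumes "0 < \<nu>" "0 < \<rho>" "omega3 * \<rho>^3 = \<nu>^3"
  shows "(Gamma3 * \<nu>)^5 \<le> 3/320 * omega3 * \<rho>^5"
proof -
  have w: "0 < omega3" "4 < omega3" using omega3_bounds by auto
  have e: "omega3^6 * \<rho>^15 = omega3 * \<nu>^15"
  proof -
    have "omega3^6 * \<rho>^15 = omega3 * (omega3 * \<rho>^3)^5"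
      by (simp add: power_mult_distrib flip: power_mult power_Suc)
    then show ?thesis by (simp add: assms(3) flip: power_mult)
  qed
  have "(Gamma1 * \<nu>^5)^3 = 1/400000 * \<nu>^15"
    by (simp add: power_mult_distrib Gamma1_cube flip: power_mult)
  also have "\<dots> \<le> (3/320)^3 * 4 * \<nu>^15"
    using assms by (intro mult_right_mono) (auto simp: power3_eq_cube)
  also have "\<dots> \<le> (3/320)^3 * omega3 * \<nu>^15"
    using assms w by (intro mult_right_mono mult_left_mono) auto
  also have "\<dots> = (3/320)^3 * (omega3^6 * \<rho>^15)" by (simp add: e)
  also have "\<dots> = (3/320 * omega3^2 * \<rho>^5)^3"
    by (simp add: power_mult_distrib power_divide flip: power_mult)
  finally have "Gamma1 * \<nu>^5 \<le> 3/320 * omega3^2 * \<rho>^5"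
    using assms w Gamma1_pos by (subst (asm) power_mono_iff) auto
  then have "omega3 * (Gamma3 * \<nu>)^5 \<le> omega3 * (3/320 * omega3 * \<rho>^5)"
    by (simp add: Gamma3_pow5[symmetric] power_mult_distrib power2_eq_square mult_ac)
  then show ?thesis using w by (simp del: mult_le_cancel_left_pos add: mult_le_cancel_left_pos)
qed

lemma voronoi_cell_singleton: "voronoi_cell {y} y = cubeQ"
  by (simp add: voronoi_cell_def)

text \<open>For \<delta> \<le> 1, inserting |V| \<le> D^3 and \<delta>^2 \<le> 2D^2 into
  \<open>minimizer_cell_mass_ge\<close> bounds D^5 from below.\<close>

lemma minimizer_diameter_ge:
  assumes min: "minimizer n Y" and y: "y \<in> Y"
  shows "Gamma3 * real n powr (-1/3) \<le> diameter (voronoi_cell Y y)"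
proof -
  have Y: "finite Y" "card Y = n" "n > 0" "Y \<subseteq> cubeQ" using minimizerD[OF min y] by auto
  obtain \<nu> \<rho> where \<nu>: "\<nu> = real n powr (-1/3)" "0 < \<nu>" "real n * \<nu>^3 = 1"
    and \<rho>: "0 < \<rho>" "omega3 * \<rho>^3 = \<nu>^3" using length_scales[OF Y(3)] by metis
  define V where "V = voronoi_cell Y y"
  define D where "D = diameter V"
  have D0: "0 \<le> D" unfolding D_def V_def
    by (intro diameter_ge_0 compact_imp_bounded compact_voronoi_cell)
  have "1 * \<nu>^3 \<le> real n * \<nu>^3" using Y(3) \<nu>(2) by (intro mult_right_mono) auto
  then have "\<nu> \<le> 1" using \<nu> power_mono_iff[of \<nu> 1 3] by simp
  have small: "Gamma3 * \<nu> \<le> 1/2"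
    using mult_mono[OF Gamma3_le \<open>\<nu> \<le> 1\<close>] \<nu>(2) by simp
  have "Gamma3 * \<nu> \<le> D"
  proof (cases "n = 1")
    case True
    then have "Y = {y}" using Y y by (metis card_1_singletonE singletonD)
    then have "dist (0::real^3) 1 \<le> D"
      unfolding D_def V_def
      by (intro diameter_bounded_bound compact_imp_bounded compact_voronoi_cell)
        (auto simp: voronoi_cell_singleton mem_cubeQ)
    moreover have "1 \<le> dist (0::real^3) 1" using component_le_norm_cart[of "1::real^3" 1] by simp
    ultimately show ?thesis using small by simp
  next
    case False
    then obtain y' where y': "y' \<in> Y" "y' \<noteq> y" "\<And>z. z \<in> Y \<Longrightarrow> z \<noteq> y \<Longrightarrow> dist y y' \<le> dist y z"
      using nearest_other_point[OF Y(1) _ y] Y by auto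
    define \<delta> where "\<delta> = dist y y'"
    have D2: "2 * h\<^sup>2 \<le> D\<^sup>2" if "0 \<le> h" "h \<le> 1/2" "h \<le> \<delta>/2" for h
      unfolding D_def V_def
      using Y y y'(3) that by (intro voronoi_cell_diameter_sq_ge[of y Y \<delta>]) (auto simp: \<delta>_def)
    show ?thesis
    \<comment> \<open>A shift by \<delta>/2 is sure to fit into the cube only if \<delta> \<le> 1;
      otherwise a shift by 1/2 already gives D \<ge> 1/2.\<close>
    proof (cases "\<delta> \<le> 1")
      case True
      have "(Gamma3 * \<nu>)^5 * 2 \<le> 3/160 * omega3 * \<rho>^5"
        using Gamma3_pow5_le[OF \<nu>(2) \<rho>] by simp
      also have "\<dots> \<le> measure lebesgue V * \<delta>\<^sup>2"
        unfolding V_def \<delta>_def using \<rho> \<nu> by (intro minimizer_cell_mass_ge[OF min y y'(1,2)]) auto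
      also have "\<dots> \<le> D^3 * (2 * D\<^sup>2)"
        using measure_le_diameter_cube[OF compact_voronoi_cell[of Y y]] D2[of "\<delta>/2"] True D0
        by (intro mult_mono) (auto simp: V_def D_def \<delta>_def power_divide)
      also have "\<dots> = D^5 * 2" by (simp add: eval_nat_numeral)
      finally have "(Gamma3 * \<nu>)^5 \<le> D^5" by simp
      then show ?thesis using D0 \<nu>(2) Gamma3_pos by (subst (asm) power_mono_iff) auto
    next
      case False
      then have "(1/2)\<^sup>2 \<le> D\<^sup>2" using D2[of "1/2"] by (simp add: power2_eq_square)
      then have "1/2 \<le> D" using D0 by (subst (asm) power_mono_iff) auto
      then show ?thesis using small by simp
    qed
  qed
  then show ?thesis by (simp add: \<nu>(1) D_def V_def)
qed

text \<open>The midpoint toward the nearest neighbour lies in the cell, so the covering radius gives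
  \<delta> \<le> 14\<nu>, and the bound on |V| \<delta>^2 becomes one on |V|. The smallness of
  \<open>Gamma5\<close> leaves room for 10^(-8) as intermediate constant.\<close>

lemma minimizer_measure_ge:
  assumes min: "minimizer n Y" and y: "y \<in> Y"
  shows "omega3 * Gamma5^3 / real n \<le> measure lebesgue (voronoi_cell Y y)"
proof -
  have Y: "finite Y" "card Y = n" "n > 0" "Y \<subseteq> cubeQ" using minimizerD[OF min y] by auto
  obtain \<nu> \<rho> where \<nu>: "0 < \<nu>" "real n * \<nu>^3 = 1"
    and \<rho>: "0 < \<rho>" "omega3 * \<rho>^3 = \<nu>^3" using length_scales[OF Y(3)] by metis
  define v where "v = measure lebesgue (voronoi_cell Y y)"
  have "omega3 * Gamma5^3 \<le> 5 * (1/800)^3"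
    using omega3_bounds Gamma5_pos Gamma5_le by (intro mult_mono power_mono) auto
  then have small: "omega3 * Gamma5^3 \<le> 1/10^8" by (simp add: power_divide)
  have n: "1 / real n = \<nu>^3" using \<nu>(2) Y(3) by (simp add: field_simps)
  have "1/10^8 * \<nu>^3 \<le> v"
  proof (cases "n = 1")
    case True
    then have "Y = {y}" using Y y by (metis card_1_singletonE singletonD)
    then show ?thesis using True n by (simp add: v_def voronoi_cell_singleton measure_cubeQ)
  next
    case False
    then obtain y' where y': "y' \<in> Y" "y' \<noteq> y" "\<And>z. z \<in> Y \<Longrightarrow> z \<noteq> y \<Longrightarrow> dist y y' \<le> dist y z"
      using nearest_other_point[OF Y(1) _ y] Y by auto
    define \<delta> where "\<delta> = dist y y'"
    have mid: "midpoint y y' \<in> voronoi_cell Y y"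
    proof (rule half_nearest_mem_voronoi_cell)
      show "midpoint y y' \<in> cubeQ"
        using Y y y' convex_cubeQ midpoints_in_convex_hull[of y cubeQ y'] by (auto simp: hull_same subset_iff)
      show "dist (midpoint y y') y \<le> \<delta>/2" by (simp add: \<delta>_def dist_midpoint)
    qed (use y' in \<open>auto simp: \<delta>_def\<close>)
    then have "dist (midpoint y y') y \<le> 7 * \<nu>"
      using \<nu> by (intro minimizer_voronoi_radius[OF min y mid]) auto
    then have "\<delta> \<le> 14 * \<nu>" by (simp add: \<delta>_def dist_midpoint)
    \<comment> \<open>Since \<open>omega3\<close> < 8, the ball of radius \<nu>/2 has volume below
      \<nu>^3.\<close>
    have "(\<nu>/2)^3 * omega3 \<le> (\<nu>/2)^3 * 8" using omega3_bounds \<nu> by (intro mult_left_mono) auto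
    then have "omega3 * (\<nu>/2)^3 \<le> omega3 * \<rho>^3" by (simp add: \<rho>(2) power_divide mult.commute)
    then have "\<nu>/2 \<le> \<rho>" using omega3_bounds \<rho>(1) \<nu>(1) by (simp add: power_mono_iff)
    have "1/10^8 * \<nu>^3 * (14 * \<nu>)\<^sup>2 \<le> 3/160 * \<nu>^3 * (\<nu>/2)\<^sup>2"
      using \<nu>(1) by (simp add: power_mult_distrib power_divide)
    also have "\<dots> \<le> 3/160 * \<nu>^3 * \<rho>\<^sup>2"
      using \<open>\<nu>/2 \<le> \<rho>\<close> \<nu>(1) by (intro mult_left_mono power_mono) auto
    also have "\<dots> = 3/160 * omega3 * \<rho>^5" unfolding \<rho>(2)[symmetric] by (simp add: eval_nat_numeral)
    also have "\<dots> \<le> v * \<delta>\<^sup>2"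
      unfolding v_def \<delta>_def using \<rho> \<nu> by (intro minimizer_cell_mass_ge[OF min y y'(1,2)]) auto
    also have "\<dots> \<le> v * (14 * \<nu>)\<^sup>2"
      using \<open>\<delta> \<le> 14 * \<nu>\<close> by (intro mult_left_mono power_mono) (auto simp: v_def \<delta>_def)
    finally show ?thesis by (rule mult_right_le_imp_le) (use \<nu>(1) in simp)
  qed
  moreover have "omega3 * Gamma5^3 / real n \<le> 1/10^8 * \<nu>^3"
    using mult_right_mono[OF small, of "1 / real n"] unfolding n[symmetric] by simp
  ultimately show ?thesis unfolding v_def by (rule order_trans[rotated])
qed

lemma minimizer_diameter_le:
  assumes min: "minimizer n Y" and y: "y \<in> Y" and "n \<ge> 3"
  shows "diameter (voronoi_cell Y y) \<le> Gamma4 * (real n - 2) powr (-1/3)"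
proof -
  obtain \<nu> \<rho> where \<nu>: "\<nu> = real n powr (-1/3)" "0 < \<nu>" "real n * \<nu>^3 = 1"
    using length_scales[of n] assms by (metis not_numeral_le_zero gr0I)
  have "diameter (voronoi_cell Y y) \<le> 14 * \<nu>"
  proof (rule diameter_le)
    fix x x' assume "x \<in> voronoi_cell Y y" "x' \<in> voronoi_cell Y y"
    then have "dist x y \<le> 7 * \<nu>" "dist x' y \<le> 7 * \<nu>"
      using minimizer_voronoi_radius[OF min y] \<nu> by auto
    then show "norm (x - x') \<le> 14 * \<nu>"
      using dist_triangle[of x x' y] by (simp add: dist_norm norm_minus_commute)
  qed (use \<nu> in auto)
  \<comment> \<open>With n \<ge> 3 the base n - 2 is positive, as monotonicity of a negative power
    requires.\<close>
  also have "\<dots> \<le> Gamma4 * (real n - 2) powr (-1/3)"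
    unfolding \<nu>(1) using Gamma4_ge assms(3) by (intro mult_mono powr_mono2') auto
  finally show ?thesis .
qed

text \<open>In the packing bound with R = 7\<nu> both \<open>omega3\<close> and \<open>n\<close>
  cancel, leaving k + 1 \<le> (21 / \<open>Gamma5\<close>)^3. \<open>Nstar\<close> is at least 16
  times this, which absorbs the six faces of the cube.\<close>

lemma minimizer_card_facets_le:
  assumes min: "minimizer n Y" and y: "y \<in> Y"
  shows "real (card {C. C facet_of voronoi_cell Y y}) \<le> Nstar"
proof -
  have Y: "finite Y" "card Y = n" "n > 0" "Y \<subseteq> cubeQ" using minimizerD[OF min y] by auto
  obtain \<nu> where \<nu>: "0 < \<nu>" "real n * \<nu>^3 = 1" using length_scales[OF Y(3)] by metis
  have n: "1 / real n = \<nu>^3" using \<nu>(2) Y(3) by (simp add: field_simps)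
  define k where "k = card {z \<in> Y - {y}. \<exists>x\<in>voronoi_cell Y y. dist x y = dist x z}"
  define X where "X = (21 / Gamma5)^3"
  have "real (k + 1) * (omega3 * Gamma5^3 / real n) \<le> omega3 * (3 * (7 * \<nu>))^3"
    unfolding k_def using \<nu>
    by (intro card_neighbours_mult_le Y y minimizer_measure_ge[OF min])
      (auto intro: minimizer_voronoi_radius[OF min])
  then have "omega3 * \<nu>^3 * (real (k + 1) * Gamma5^3) \<le> omega3 * \<nu>^3 * 21^3"
    unfolding divide_inverse using n by (simp add: power_mult_distrib divide_inverse mult_ac)
  then have "real (k + 1) * Gamma5^3 \<le> 21^3"
    using omega3_bounds \<nu>(1) by (subst (asm) mult_le_cancel_left_pos) auto
  then have k: "real k + 1 \<le> X"
    using Gamma5_pos by (simp add: X_def power_divide pos_le_divide_eq algebra_simps)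
  have "real (card {C. C facet_of voronoi_cell Y y}) \<le> 6 + real k"
    using card_facets_voronoi_cell_le[OF Y(1) y] by (simp add: k_def)
  also have "\<dots> \<le> 2 * (8 * X)" using k by simp
  also have "8 * X = (3 * 14 / Gamma5)^3" by (simp add: X_def power_divide)
  also have "2 * \<dots> \<le> Nstar"
    unfolding Nstar_def using Gamma4_ge Gamma5_pos
    by (intro mult_left_mono power_mono divide_right_mono) auto
  finally show ?thesis by simp
qed

section \<open>Existence of minimizers and scaling\<close>

text \<open>Induction on the number of indices, refining the subsequence once for each.\<close>

lemma convergent_subsequence_finite_family:
  fixes f :: "nat \<Rightarrow> nat \<Rightarrow> 'a::metric_space"
  assumes "compact K" "\<And>k i. i < n \<Longrightarrow> f k i \<in> K"
  shows "\<exists>r l. strict_mono r \<and> (\<forall>i<n. l i \<in> K \<and> (\<lambda>k. f (r k) i) \<longlonglongrightarrow> l i)"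
  using assms(2)
proof (induction n)
  case 0
  show ?case by (intro exI[of _ id]) (auto simp: strict_mono_def)
next
  case (Suc n)
  then obtain r l where r: "strict_mono r" "\<And>i. i < n \<Longrightarrow> l i \<in> K \<and> (\<lambda>k. f (r k) i) \<longlonglongrightarrow> l i"
    by (metis less_SucI)
  have "\<forall>k. f (r k) n \<in> K" using Suc.prems by simp
  then obtain a s where s: "a \<in> K" "strict_mono s" "((\<lambda>k. f (r k) n) \<circ> s) \<longlonglongrightarrow> a"
    using assms(1) unfolding compact_def by metis
  have "(\<lambda>k. f ((r \<circ> s) k) i) \<longlonglongrightarrow> (if i = n then a else l i)" if "i < Suc n" for i
  proof (cases "i = n")
    case False
    then have "(\<lambda>k. f (r k) i) \<longlonglongrightarrow> l i" using r that by simp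
    then show ?thesis using LIMSEQ_subseq_LIMSEQ[OF _ s(2)] False by (auto simp: o_def)
  qed (use s in \<open>auto simp: o_def\<close>)
  then show ?case
    using r s by (intro exI[of _ "r \<circ> s"] exI[of _ "\<lambda>i. if i = n then a else l i"])
      (auto simp: strict_mono_def less_Suc_eq)
qed

text \<open>Expand (d + \<eta>)^2 with d \<le> 2 on the cube. This is the one-sided continuity
  behind the existence of minimizers.\<close>

lemma energy_perturb_le:
  assumes "finite A" "A \<noteq> {}" "A \<subseteq> cubeQ" "0 \<le> \<eta>" "\<And>a. a \<in> A \<Longrightarrow> \<exists>b\<in>B. dist a b \<le> \<eta>"
  shows "energy B \<le> energy A + (4 * \<eta> + \<eta>\<^sup>2)"
proof -
  have "energy B \<le> energy A + integral cubeQ (\<lambda>_. 4 * \<eta> + \<eta>\<^sup>2)"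
  proof (rule energy_le_add_integral)
    fix x assume x: "x \<in> cubeQ"
    obtain a where a: "a \<in> A" "infdist x A = dist x a" using infdist_attained[OF assms(1,2)] .
    obtain b where b: "b \<in> B" "dist a b \<le> \<eta>" using assms(5)[OF a(1)] by blast
    have "infdist x B \<le> dist x a + \<eta>"
      using infdist_le[OF b(1), of x] dist_triangle[of x b a] b(2) by simp
    then have "(infdist x B)\<^sup>2 \<le> (dist x a + \<eta>)\<^sup>2" by (intro power_mono infdist_nonneg)
    also have "\<dots> = (dist x a)\<^sup>2 + (2 * \<eta> * dist x a + \<eta>\<^sup>2)" by (simp add: power2_eq_square algebra_simps)
    also have "2 * \<eta> * dist x a \<le> 2 * \<eta> * 2"
      using dist_cubeQ_le_2[OF x, of a] a assms by (intro mult_left_mono) auto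
    finally show "(infdist x B)\<^sup>2 \<le> (infdist x A)\<^sup>2 + (4 * \<eta> + \<eta>\<^sup>2)" using a by simp
  qed (auto simp: cubeQ_def)
  also have "integral cubeQ (\<lambda>_. 4 * \<eta> + \<eta>\<^sup>2) = 4 * \<eta> + \<eta>\<^sup>2"
    using measure_cubeQ by (simp add: cubeQ_def)
  finally show ?thesis .
qed

lemma energy_nonneg: "0 \<le> energy Y"
  unfolding energy_def by (intro integral_nonneg integrable_infdist_sq) auto

text \<open>Direct method: enumerate a minimizing sequence and pass to limits point by point. The
  hypothesis on \<tau> yields a lower bound only once some sequence of minimizers is known.\<close>

lemma minimizer_exists: "\<exists>Y. minimizer n Y"
proof (cases "n = 0")
  case True
  then show ?thesis by (intro exI[of _ "{}"]) (auto simp: minimizer_def)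
next
  case False
  define \<C> where "\<C> = {Z. Z \<subseteq> cubeQ \<and> finite Z \<and> card Z = n}"
  define m where "m = Inf (energy ` \<C>)"
  obtain Z0 where "Z0 \<in> \<C>"
    unfolding \<C>_def using infinite_arbitrarily_large[OF infinite_cubeQ, of n] by blast
  have bdd: "bdd_below (energy ` \<C>)" by (auto intro: bdd_belowI[of _ 0] energy_nonneg)
  have m: "m \<le> energy Z" if "Z \<in> \<C>" for Z
    unfolding m_def using bdd that by (intro cInf_lower) auto
  have "\<exists>Z\<in>\<C>. energy Z < m + 1 / Suc k" for k
    using cInf_lessD[of "energy ` \<C>" "m + 1 / Suc k"] \<open>Z0 \<in> \<C>\<close> unfolding m_def by auto
  then obtain Z where Z: "\<And>k. Z k \<in> \<C>" "\<And>k. energy (Z k) < m + 1 / Suc k" by metis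
  have "\<exists>f. bij_betw f {..<n} (Z k)" for k
    using Z(1)[of k] ex_bij_betw_nat_finite[of "Z k"] by (auto simp: \<C>_def atLeast0LessThan)
  then obtain f where f: "\<And>k. bij_betw (f k) {..<n} (Z k)" by metis
  have fQ: "f k i \<in> cubeQ" if "i < n" for k i
    using bij_betw_apply[OF f[of k]] that Z(1)[of k] by (auto simp: \<C>_def)
  obtain r l where r: "strict_mono r" "\<And>i. i < n \<Longrightarrow> l i \<in> cubeQ"
    "\<And>i. i < n \<Longrightarrow> (\<lambda>k. f (r k) i) \<longlonglongrightarrow> l i"
    using convergent_subsequence_finite_family[OF compact_cubeQ, of n f] fQ by blast
  let ?L = "l ` {..<n}"
  have "energy ?L \<le> m + e" if "0 < e" for e
  proof -
    \<comment> \<open>The total error is \<eta> from near-minimality plus 4\<eta> + \<eta>^2, at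
      most 6\<eta>.\<close>
    define \<eta> where "\<eta> = min 1 (e / 10)"
    have \<eta>: "0 < \<eta>" "\<eta> \<le> 1" "10 * \<eta> \<le> e" using that by (auto simp: \<eta>_def)
    have "\<forall>\<^sub>F k in sequentially. \<forall>i\<in>{..<n}. dist (f (r k) i) (l i) < \<eta>"
      using r(3) \<eta>(1) by (intro eventually_ball_finite) (auto dest: tendstoD)
    moreover have "\<forall>\<^sub>F k in sequentially. 1 / real (Suc k) < \<eta>"
      using LIMSEQ_inverse_real_of_nat order_tendstoD(2)[of _ 0 sequentially \<eta>] \<eta>(1)
      by (simp add: inverse_eq_divide)
    ultimately have "\<forall>\<^sub>F k in sequentially.
        (\<forall>i\<in>{..<n}. dist (f (r k) i) (l i) < \<eta>) \<and> 1 / real (Suc k) < \<eta>"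
      by (rule eventually_conj)
    then obtain k where k: "\<And>i. i < n \<Longrightarrow> dist (f (r k) i) (l i) < \<eta>" "1 / real (Suc k) < \<eta>"
      by (auto simp: eventually_sequentially)
    have "energy ?L \<le> energy (Z (r k)) + (4 * \<eta> + \<eta>\<^sup>2)"
    proof (rule energy_perturb_le)
      show "finite (Z (r k))" "Z (r k) \<subseteq> cubeQ" "Z (r k) \<noteq> {}"
        using Z(1)[of "r k"] False by (auto simp: \<C>_def)
      fix a assume "a \<in> Z (r k)"
      then obtain i where "i < n" "a = f (r k) i"
        using f[of "r k"] by (auto simp: bij_betw_def)
      then show "\<exists>b\<in>?L. dist a b \<le> \<eta>" using k(1)[of i] by force
    qed (use \<eta> in auto)
    moreover have "1 / real (Suc (r k)) \<le> 1 / real (Suc k)"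
      using seq_suble[OF r(1), of k] by (intro divide_left_mono) auto
    moreover have "\<eta>\<^sup>2 \<le> \<eta>" using \<eta> by (simp add: power2_eq_square mult_left_le)
    ultimately show ?thesis using Z(2)[of "r k"] k(2) \<eta> by simp
  qed
  then have L: "energy ?L \<le> m" by (rule field_le_epsilon)
  \<comment> \<open>Limit points may coincide, so the limit set is refilled to \<open>n\<close>
    points without raising the energy.\<close>
  have "card ?L \<le> n" using card_image_le[of "{..<n}" l] by simp
  then obtain W where W: "W \<subseteq> cubeQ" "finite W" "card W = n" "energy W \<le> energy ?L"
    using exists_subset_cubeQ_energy_le[of ?L n] False by auto
  have "energy W \<le> energy Z" if "Z \<in> \<C>" for Z
    using order_trans[OF W(4) order_trans[OF L m[OF that]]] .
  then have "minimizer n W"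
    using W(1-3) unfolding minimizer_def \<C>_def by blast
  then show ?thesis by blast
qed

text \<open>Eight half-size copies of \<open>Y\<close>, one in each subcube of half the side length.\<close>

lemma energy_half_copies:
  assumes "finite Y" "Y \<noteq> {}"
  shows "\<exists>Z. finite Z \<and> Z \<noteq> {} \<and> card Z \<le> 8 * card Y \<and> energy Z \<le> energy Y / 4"
proof -
  define J where "J = (\<lambda>(a, b, c). vector [a, b, c] :: real^3) ` ({0, 1} \<times> {0, 1} \<times> {0, 1})"
  define T where "T j p = (1/2) *\<^sub>R (p + j)" for j p :: "real^3"
  define Z where "Z = (\<Union>j\<in>J. T j ` Y)"
  have J: "finite J" "card J \<le> 8"
  proof -
    show "finite J" by (simp add: J_def)
    show "card J \<le> 8"
      unfolding J_def by (rule order_trans[OF card_image_le]) (auto simp: card_cartesian_product)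
  qed
  have J_ne: "J \<noteq> {}" by (simp add: J_def)
  \<comment> \<open>Halving lengths scales volume by 1/8 and squared distance by 1/4, so each copy
    carries 1/32 of the energy.\<close>
  have copy: "((\<lambda>x. (infdist x (T j ` Y))\<^sup>2) has_integral energy Y / 32) (T j ` cubeQ)" for j
  proof -
    have "((\<lambda>x. (infdist x Y)\<^sup>2) has_integral energy Y) (cbox 0 1)"
      using integrable_infdist_sq[of Y] by (simp add: has_integral_iff energy_def cubeQ_def)
    from has_integral_affinity[OF this, of 2 "- j"]
    have "((\<lambda>x. (infdist (2 *\<^sub>R x - j) Y)\<^sup>2) has_integral energy Y / 8) (T j ` cubeQ)"
      by (simp add: T_def[abs_def] cubeQ_def algebra_simps)
    then have "((\<lambda>x. 1/4 * (infdist (2 *\<^sub>R x - j) Y)\<^sup>2) has_integral 1/4 * (energy Y / 8)) (T j ` cubeQ)"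
      by (rule has_integral_mult_right)
    moreover have "1/4 * (infdist (2 *\<^sub>R x - j) Y)\<^sup>2 = (infdist x (T j ` Y))\<^sup>2" for x
    proof -
      have d: "dist x (T j p) = dist (2 *\<^sub>R x - j) p / 2" for p
      proof -
        have "x - T j p = (1/2) *\<^sub>R (2 *\<^sub>R x - j - p)" by (simp add: T_def algebra_simps)
        then show ?thesis by (simp add: dist_norm)
      qed
      have "infdist x (T j ` Y) = infdist (2 *\<^sub>R x - j) Y / 2"
      proof (rule antisym)
        obtain p where "p \<in> Y" "infdist (2 *\<^sub>R x - j) Y = dist (2 *\<^sub>R x - j) p"
          using infdist_attained[OF assms] .
        then show "infdist x (T j ` Y) \<le> infdist (2 *\<^sub>R x - j) Y / 2"
          using infdist_le[of "T j p" "T j ` Y" x] d[of p] by simp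
        obtain q where "q \<in> T j ` Y" "infdist x (T j ` Y) = dist x q"
          using infdist_attained[of "T j ` Y" x] assms by auto
        then show "infdist (2 *\<^sub>R x - j) Y / 2 \<le> infdist x (T j ` Y)"
          using infdist_le[of _ Y "2 *\<^sub>R x - j"] d by auto
      qed
      then have "(infdist x (T j ` Y))\<^sup>2 = (infdist (2 *\<^sub>R x - j) Y / 2)\<^sup>2" by (rule arg_cong)
      then show ?thesis by (simp add: power_divide)
    qed
    ultimately show ?thesis by simp
  qed
  have cover: "\<exists>j\<in>J. x \<in> T j ` cubeQ" if "x \<in> cubeQ" for x
  proof -
    define s where "s i = (if x$i \<le> 1/2 then 0 else 1 :: real)" for i
    define j where "j = (vector [s 1, s 2, s 3] :: real^3)"
    have "j \<in> J" unfolding J_def j_def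
      by (rule image_eqI[of _ _ "(s 1, s 2, s 3)"]) (auto simp: s_def)
    moreover have "2 *\<^sub>R x - j \<in> cubeQ"
      using that unfolding mem_cubeQ forall_3 j_def s_def by (auto simp: vector_3)
    moreover have "x = T j (2 *\<^sub>R x - j)" by (simp add: T_def)
    ultimately show ?thesis by blast
  qed
  have T_cube: "compact (T j ` cubeQ)" for j
    unfolding T_def by (intro compact_continuous_image compact_cubeQ continuous_intros)
  let ?f = "\<lambda>x. (infdist x Z)\<^sup>2"
  have fi: "?f integrable_on (T j ` cubeQ)" and
    fle: "integral (T j ` cubeQ) ?f \<le> energy Y / 32" if "j \<in> J" for j
  proof -
    have "T j ` cubeQ \<subseteq> cubeQ"
    proof -
      have j: "0 \<le> j$i \<and> j$i \<le> 1" for i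
        using that by (cases i rule: exhaust_3[THEN disjE]) (auto simp: J_def vector_3 forall_3)
      have "0 \<le> T j p $ i \<and> T j p $ i \<le> 1" if "p \<in> cubeQ" for p i
        using j[of i] that[unfolded mem_cubeQ, rule_format, of i] by (simp add: T_def)
      then show ?thesis by (auto simp: mem_cubeQ)
    qed
    then show fi: "?f integrable_on (T j ` cubeQ)"
      using T_cube[of j] lmeasurable_compact
      by (intro integrable_on_lmeasurable_subset continuous_infdist_sq) blast+
    have "integral (T j ` cubeQ) ?f \<le> integral (T j ` cubeQ) (\<lambda>x. (infdist x (T j ` Y))\<^sup>2)"
    proof (intro integral_le fi has_integral_integrable[OF copy] infdist_sq_mono infdist_mono)
      show "T j ` Y \<subseteq> Z" using that by (auto simp: Z_def)
    qed (use assms in auto)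
    then show "integral (T j ` cubeQ) ?f \<le> energy Y / 32"
      using integral_unique[OF copy] by simp
  qed
  have "energy Z \<le> (\<Sum>j\<in>J. integral (T j ` cubeQ) ?f)"
  proof -
    \<comment> \<open>Subcubes share faces; as the integrand is nonnegative, summing over all of
      them still gives an upper bound.\<close>
    let ?g = "\<lambda>j x. if x \<in> T j ` cubeQ then ?f x else 0"
    have gi: "?g j integrable_on UNIV" if "j \<in> J" for j
      using fi[OF that] by (simp add: integrable_restrict_UNIV)
    have "energy Z = integral UNIV (\<lambda>x. if x \<in> cubeQ then ?f x else 0)"
      by (simp add: energy_def integral_restrict_UNIV)
    also have "\<dots> \<le> integral UNIV (\<lambda>x. \<Sum>j\<in>J. ?g j x)"
    proof (rule integral_le)
      show "(\<lambda>x. if x \<in> cubeQ then ?f x else 0) integrable_on UNIV"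
        using integrable_infdist_sq by (simp add: integrable_restrict_UNIV)
      show "(\<lambda>x. \<Sum>j\<in>J. ?g j x) integrable_on UNIV" using J gi by (intro integrable_sum) auto
      fix x
      show "(if x \<in> cubeQ then ?f x else 0) \<le> (\<Sum>j\<in>J. ?g j x)"
      proof (cases "x \<in> cubeQ")
        case True
        then obtain j where j: "j \<in> J" "x \<in> T j ` cubeQ" using cover by blast
        then have "?f x = ?g j x" by simp
        also have "\<dots> \<le> (\<Sum>j\<in>J. ?g j x)" using j J by (intro member_le_sum) auto
        finally show ?thesis using True by simp
      qed (simp add: sum_nonneg)
    qed
    also have "\<dots> = (\<Sum>j\<in>J. integral UNIV (?g j))" using J gi by (intro integral_sum) auto
    finally show ?thesis by (simp add: integral_restrict_UNIV)
  qed
  also have "\<dots> \<le> (\<Sum>j\<in>J. energy Y / 32)" by (intro sum_mono fle)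
  also have "\<dots> = real (card J) * (energy Y / 32)" by simp
  also have "\<dots> \<le> 8 * (energy Y / 32)" using J energy_nonneg[of Y] by (intro mult_right_mono) auto
  finally have "energy Z \<le> energy Y / 4" by simp
  moreover have "card Z \<le> 8 * card Y"
  proof -
    have "card Z \<le> (\<Sum>j\<in>J. card (T j ` Y))" unfolding Z_def using J by (intro card_UN_le)
    also have "\<dots> \<le> (\<Sum>j\<in>J. card Y)" using assms by (intro sum_mono card_image_le)
    also have "\<dots> \<le> 8 * card Y" using J by simp
    finally show ?thesis .
  qed
  moreover have "finite Z" "Z \<noteq> {}" using J J_ne assms by (auto simp: Z_def)
  ultimately show ?thesis by blast
qed

text \<open>Eight copies quarter the energy and 8^(2/3) = 4, so the two factors cancel in the step
  from \<open>n\<close> to \<open>8 * n\<close>.\<close>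

lemma minimizer_scaled_energy_le:
  assumes min: "\<And>n. minimizer n (Ys n)" and "n > 0"
  shows "real (8^k * n) powr (2/3) * energy (Ys (8^k * n)) \<le> real n powr (2/3) * energy (Ys n)"
proof (induction k)
  case (Suc k)
  define N where "N = 8^k * n"
  have N: "finite (Ys N)" "card (Ys N) = N" "N > 0" using min[of N] assms by (auto simp: minimizer_def N_def)
  have "Ys N \<noteq> {}" using N by auto
  then obtain Z where Z: "finite Z" "Z \<noteq> {}" "card Z \<le> 8 * N" "energy Z \<le> energy (Ys N) / 4"
    using energy_half_copies[OF N(1)] unfolding N(2) by blast
  have "energy (Ys (8 * N)) \<le> energy (Ys N) / 4"
    using minimizer_energy_le[OF min Z(1-3)] Z(4) by simp
  moreover have "real (8 * N) powr (2/3) = 4 * real N powr (2/3)"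
  proof -
    have "(8::real) powr (2/3) = ((2 powr 3) powr (2/3))" by simp
    also have "\<dots> = 4" by (subst powr_powr) simp
    finally show ?thesis by (simp add: powr_mult)
  qed
  ultimately have "real (8 * N) powr (2/3) * energy (Ys (8 * N))
      \<le> 4 * real N powr (2/3) * (energy (Ys N) / 4)"
    by (metis mult_left_mono powr_ge_zero)
  then show ?case using Suc by (simp add: N_def mult.assoc)
qed simp

section \<open>Lower bound for the energy and conclusion\<close>

text \<open>Outside the balls of radius \<open>s\<close> the integrand is at least s^2, and the
  balls cover at most the sum of their volumes.\<close>

lemma energy_ge:
  assumes "finite Y" "Y \<noteq> {}" "0 \<le> s"
  shows "s\<^sup>2 * (1 - real (card Y) * (omega3 * s^3)) \<le> energy Y"
proof -
  define B where "B = (\<Union>y\<in>Y. ball y s)"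
  have B: "B \<inter> cubeQ \<in> lmeasurable" unfolding B_def cubeQ_def
    using assms(1) by (intro fmeasurable.Int fmeasurable.finite_UN) auto
  have "measure lebesgue (B \<inter> cubeQ) \<le> measure lebesgue B"
    using B assms(1) unfolding B_def by (intro measure_mono_fmeasurable fmeasurable.finite_UN) auto
  also have "\<dots> \<le> (\<Sum>y\<in>Y. measure lebesgue (ball y s))"
    unfolding B_def using assms(1) by (intro measure_UNION_le) auto
  also have "\<dots> = real (card Y) * (omega3 * s^3)" using measure_ball_3(1)[OF assms(3)] by simp
  finally have m: "measure lebesgue (B \<inter> cubeQ) \<le> real (card Y) * (omega3 * s^3)" .
  have i1: "((\<lambda>_. 1::real) has_integral 1) cubeQ"
    using has_integral_const[of "1::real" 0 "1::real^3"] measure_cubeQ by (simp add: cubeQ_def)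
  have i2: "((indicator B :: _ \<Rightarrow> real) has_integral measure lebesgue (B \<inter> cubeQ)) cubeQ"
    using B by (simp add: has_integral_iff integral_indicator integrable_on_indicator)
  have "((\<lambda>x. s\<^sup>2 * (1 - indicator B x)) has_integral s\<^sup>2 * (1 - measure lebesgue (B \<inter> cubeQ))) cubeQ"
    by (intro has_integral_mult_right has_integral_diff i1 i2)
  moreover have "((\<lambda>x. (infdist x Y)\<^sup>2) has_integral energy Y) cubeQ"
    using integrable_infdist_sq by (simp add: energy_def has_integral_iff)
  ultimately have "s\<^sup>2 * (1 - measure lebesgue (B \<inter> cubeQ)) \<le> energy Y"
  proof (rule has_integral_le)
    fix x
    obtain y where y: "y \<in> Y" "infdist x Y = dist x y" using infdist_attained[OF assms(1,2)] .
    show "s\<^sup>2 * (1 - indicator B x) \<le> (infdist x Y)\<^sup>2"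
    proof (cases "x \<in> B")
      case False
      then have "s \<le> dist x y" using y(1) by (auto simp: B_def dist_commute not_less)
      then show ?thesis using y(2) assms(3) False by (simp add: power_mono)
    qed simp
  qed
  moreover have "s\<^sup>2 * (1 - real (card Y) * (omega3 * s^3)) \<le> s\<^sup>2 * (1 - measure lebesgue (B \<inter> cubeQ))"
    using m by (intro mult_left_mono) auto
  ultimately show ?thesis by simp
qed

lemma scaled_energy_ge:
  assumes "finite Y" "card Y = n" "n > 0"
  shows "2 * pi / 5 * omega3 powr (-5/3) \<le> real n powr (2/3) * energy Y"
proof -
  obtain \<nu> \<rho> where \<nu>: "\<nu> = real n powr (-1/3)" "0 < \<nu>" "real n * \<nu>^3 = 1"
    and \<rho>: "\<rho> = \<nu> * omega3 powr (-1/3)" "0 < \<rho>" "omega3 * \<rho>^3 = \<nu>^3"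
    using length_scales[OF assms(3)] by metis
  \<comment> \<open>The factor s^2 (1 - s^3) is largest at s^3 = 2/5; the nearby s = 7/10 gives
    0.3219, above the 3/10 of the claim written as 3/10 * \<open>omega3 powr (-2/3)\<close>.\<close>
  have eq: "real n * (omega3 * (7/10 * \<rho>)^3) = 343/1000"
  proof -
    have "real n * (omega3 * (7/10 * \<rho>)^3) = (7/10)^3 * (real n * (omega3 * \<rho>^3))"
      unfolding power_mult_distrib by (simp only: mult_ac)
    then show ?thesis unfolding \<rho>(3) \<nu>(3) by (simp add: power_divide)
  qed
  have "Y \<noteq> {}" using assms by auto
  have "(7/10 * \<rho>)\<^sup>2 * (1 - 343/1000) \<le> energy Y"
    using energy_ge[OF assms(1) \<open>Y \<noteq> {}\<close>, of "7/10 * \<rho>", unfolded assms(2) eq] \<rho>(2) by linarith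
  moreover have "3/10 * \<rho>\<^sup>2 \<le> (7/10 * \<rho>)\<^sup>2 * (1 - 343/1000)" by (simp add: power_mult_distrib power_divide)
  ultimately have "3/10 * \<rho>\<^sup>2 \<le> energy Y" by simp
  then have "real n powr (2/3) * (3/10 * \<rho>\<^sup>2) \<le> real n powr (2/3) * energy Y"
    by (intro mult_left_mono) auto
  moreover have "real n powr (2/3) * \<rho>\<^sup>2 = omega3 powr (-2/3)"
    using assms(3) omega3_bounds unfolding \<rho>(1) \<nu>(1)
    by (simp add: power_mult_distrib powr_power powr_add[symmetric] flip: mult.assoc)
  moreover have "2 * pi / 5 * omega3 powr (-5/3) = 3/10 * omega3 powr (-2/3)"
  proof -
    have "omega3 powr (-2/3) = omega3 * omega3 powr (-5/3)"
      using omega3_bounds powr_add[of omega3 1 "-5/3"] by simp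
    then show ?thesis by (simp add: omega3_def)
  qed
  ultimately show ?thesis by simp
qed

theorem theorem2p3:
  shows "(\<forall>n Y. minimizer n Y \<longrightarrow>
           (\<forall>y\<in>Y. diameter (voronoi_cell Y y) \<ge> Gamma3 * real n powr (-1/3)
                 \<and> measure lebesgue (voronoi_cell Y y) \<ge> omega3 * Gamma5^3 / real n
                 \<and> (n \<ge> 3 \<longrightarrow> diameter (voronoi_cell Y y) \<le> Gamma4 * (real n - 2) powr (-1/3))
                 \<and> real (card {F. F facet_of (voronoi_cell Y y)}) \<le> Nstar))
       \<and> (\<forall>\<tau>::real. \<tau> > 0 \<and>
             (\<forall>Ys. (\<forall>n. minimizer n (Ys n)) \<longrightarrow>
                   (\<lambda>n. real n powr (2/3) * energy (Ys n)) \<longlonglongrightarrow> \<tau>)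
           \<longrightarrow> (\<forall>Ys. (\<forall>n. minimizer n (Ys n)) \<longrightarrow>
                   (\<forall>\<^sub>F n in sequentially. real n powr (2/3) * energy (Ys n) \<ge> \<tau>))
               \<and> \<tau> \<ge> 2 * pi / 5 * omega3 powr (-5/3))"
proof (intro conjI allI impI ballI)
  fix n Y y assume "minimizer n Y" "y \<in> Y"
  then show "diameter (voronoi_cell Y y) \<ge> Gamma3 * real n powr (-1/3)"
    "measure lebesgue (voronoi_cell Y y) \<ge> omega3 * Gamma5^3 / real n"
    "real (card {F. F facet_of (voronoi_cell Y y)}) \<le> Nstar"
    by (rule minimizer_diameter_ge minimizer_measure_ge minimizer_card_facets_le)+
  show "diameter (voronoi_cell Y y) \<le> Gamma4 * (real n - 2) powr (-1/3)" if "n \<ge> 3"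
    using \<open>minimizer n Y\<close> \<open>y \<in> Y\<close> that by (rule minimizer_diameter_le)
next
  fix \<tau> :: real
  assume \<tau>: "\<tau> > 0 \<and> (\<forall>Ys. (\<forall>n. minimizer n (Ys n)) \<longrightarrow>
    (\<lambda>n. real n powr (2/3) * energy (Ys n)) \<longlonglongrightarrow> \<tau>)"
  {
    fix Ys assume Ys: "\<forall>n. minimizer n (Ys n)"
    let ?e = "\<lambda>n. real n powr (2/3) * energy (Ys n)"
    have lim: "?e \<longlonglongrightarrow> \<tau>" using \<tau> Ys by blast
    \<comment> \<open>Along n, 8n, 64n, ... the scaled energy never exceeds its first term, and its
      limit is still \<tau>.\<close>
    have "\<tau> \<le> ?e n" if "n \<ge> 1" for n
    proof -
      have "strict_mono (\<lambda>k. 8^k * n)" using that by (intro strict_monoI) simp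
      then have "(\<lambda>k. ?e (8^k * n)) \<longlonglongrightarrow> \<tau>"
        using LIMSEQ_subseq_LIMSEQ[OF lim, of "\<lambda>k. 8^k * n"] unfolding o_def by blast
      then show ?thesis
        using minimizer_scaled_energy_le[of Ys n] Ys that by (intro LIMSEQ_le_const2) auto
    qed
    then show "\<forall>\<^sub>F n in sequentially. ?e n \<ge> \<tau>" by (auto simp: eventually_sequentially)
  }
  obtain Ys where Ys: "\<forall>n. minimizer n (Ys n)" using minimizer_exists by metis
  have "2 * pi / 5 * omega3 powr (-5/3) \<le> real n powr (2/3) * energy (Ys n)" if "n \<ge> 1" for n
    using Ys that by (intro scaled_energy_ge) (auto simp: minimizer_def)
  moreover have "(\<lambda>n. real n powr (2/3) * energy (Ys n)) \<longlonglongrightarrow> \<tau>" using \<tau> Ys by blast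
  ultimately show "\<tau> \<ge> 2 * pi / 5 * omega3 powr (-5/3)"
    by (intro LIMSEQ_le_const) auto
qed

end
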